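(* The simplex category $\Delta$ (nonempty finite ordered sets and order-preserving maps) is a $1$-concrete $(\infty,1)$-category. That is, there is a $1$-concrete $(\infty,1)$-category whose underlying categorical data $(\mathrm{obj},\hom,\mathrm{ident},\mathrm{cmp})$ is that of $\Delta$.
   Context: We work in homotopy type theory (as in the HoTT book), with $\mathrm{Type}$ a universe of types; universe levels are not emphasised. $x\equiv y$ denotes the path (identity) type. A map is $k$-truncated if all its homotopy fibres are $k$-truncated types; a proposition is a $(-1)$-truncated type. A $1$-concrete $(\infty,1)$-category consists of: - a type $\mathrm{obj}$ of objects and an object realisation map $\mathrm{obj}^+:\mathrm{obj}\to\mathrm{Type}$; - for all $x,y:\mathrm{obj}$, a type $\hom(x,y)$ and a map $\hom^+:\hom(x,y)\to\bigl(\mathrm{obj}^+(x)\to\mathrm{obj}^+(y)\bigr)$; - for all $x,y:\mathrm{obj}$, a proof $\mathrm{conf}(x,y)$ that this map $\hom^+$ is $(-1)$-truncated; - for every $x:\mathrm{obj}$, an element $\mathrm{ident}'(x)$ of the homotopy fibre of $\hom^+$ at $\mathrm{id}_{\mathrm{obj}^+(x)}$; - for all $x,y,z:\mathrm{obj}$, $g:\hom(y,z)$ and $f:\hom(x,y)$, an element $\mathrm{cmp}'(g,f)$ of the homotopy fibre of $\hom^+$ at $\hom^+(g)\circ\hom^+(f)$. Write $\mathrm{ident}(x):\hom(x,x)$ and $\mathrm{cmp}(g,f):\hom(x,z)$ for the first components of $\mathrm{ident}'(x)$ and $\mathrm{cmp}'(g,f)$. The underlying categorical data is $(\mathrm{obj},\hom,\mathrm{ident},\mathrm{cmp})$.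 Model of $\Delta$: the objects are the natural numbers $n:\mathbb{N}$, with $n$ standing for the nonempty finite ordered set $\mathrm{Fin}(n+1)$ of $n+1$ elements. Here $\mathrm{Fin}$ is the inductive family with constructors $0:\mathrm{Fin}(n+1)$ and $S:\mathrm{Fin}(n)\to\mathrm{Fin}(n+1)$. The morphisms from $m$ to $n$ are the order-preserving (weakly monotone) maps $\mathrm{Fin}(m+1)\to\mathrm{Fin}(n+1)$, modelled by the type $\mathrm{Ord}(m+1,n+1)$, where $\mathrm{Ord}$ is the inductive family with constructors $0:\mathrm{Ord}(0,0)$, $S^l:\mathrm{Ord}(m,n+1)\to\mathrm{Ord}(m+1,n+1)$ and $S^r:\mathrm{Ord}(m,n)\to\mathrm{Ord}(m,n+1)$. An element $f$ of $\mathrm{Ord}(m,n)$ represents a function $\mathrm{Fin}(m)\to\mathrm{Fin}(n)$ as follows: $0$ represents the unique function $\mathrm{Fin}(0)\to\mathrm{Fin}(0)$; $S^l(f)(0)=0$ and $S^l(f)(S(i))=f(i)$; and $S^r(f)(i)=S(f(i))$. Identities and composition are the usual ones of order-preserving maps. *)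

theory Defs
  imports Main
begin

text \<open>
  The ambient theory is homotopy type theory, not HOL, so its deductive system is formalised as an
  object logic: dependent type theory in the style of the first formal presentation in the appendix
  of the HoTT book (typed \<open>\<lambda>\<close>-calculus with constants; judgmental equality is convertibility of terms),
  with a cumulative hierarchy of universes, \<open>\<Pi>\<close>, \<open>\<Sigma>\<close>, \<open>+\<close>, \<open>0\<close>, \<open>1\<close>, natural numbers, identity types, the
  two inductive families \<open>Fin\<close> and \<open>Ord\<close>, function extensionality and univalence.
  A statement of homotopy type theory is a closed type, and it holds if that type is inhabited by
  a closed term.
\<close>

section \<open>Terms\<close>

datatype const =
    cSigma | cPair | cIndSigma
  | cSum | cInl | cInr | cIndSum
  | cEmpty | cIndEmpty
  | cUnit | cStar | cIndUnit
  | cNat | cZero | cSucc | cIndNat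
  | cId | cRefl | cIndId
  | cFin | cFZero | cFSucc | cIndFin
  | cOrd | cOZero | cOSl | cOSr | cIndOrd
  | cFunext | cUnivalence

text \<open>Variables are de Bruijn indices; \<open>Pi A B\<close> and \<open>Lam b\<close> bind index 0 in \<open>B\<close> and \<open>b\<close>.\<close>

datatype tm = Var nat | U nat | Pi tm tm | Lam tm | App tm tm | Const const

primrec lift :: "nat \<Rightarrow> tm \<Rightarrow> tm" where
  "lift k (Var n) = Var (if n < k then n else Suc n)"
| "lift k (U i) = U i"
| "lift k (Pi A B) = Pi (lift k A) (lift (Suc k) B)"
| "lift k (Lam b) = Lam (lift (Suc k) b)"
| "lift k (App f a) = App (lift k f) (lift k a)"
| "lift k (Const c) = Const c"

text \<open>\<open>subst k u t\<close> replaces index \<open>k\<close> of \<open>t\<close> by \<open>u\<close> and removes that variable from the context.\<close>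

primrec subst :: "nat \<Rightarrow> tm \<Rightarrow> tm \<Rightarrow> tm" where
  "subst k u (Var n) = (if n < k then Var n else if n = k then u else Var (n - 1))"
| "subst k u (U i) = U i"
| "subst k u (Pi A B) = Pi (subst k u A) (subst (Suc k) (lift 0 u) B)"
| "subst k u (Lam b) = Lam (subst (Suc k) (lift 0 u) b)"
| "subst k u (App f a) = App (subst k u f) (subst k u a)"
| "subst k u (Const c) = Const c"


section \<open>Notation for terms with named variables\<close>

text \<open>
  To write concrete terms legibly, a term is built as a function of the number of binders
  it stands under. A variable bound at depth \<open>d\<close> and used at depth \<open>e\<close> is the index \<open>e - Suc d\<close>.
  A closed term is obtained by applying the builder to depth 0.
\<close>

type_synonym term_at = "nat \<Rightarrow> tm"

definition bound_var :: "nat \<Rightarrow> term_at" where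
  "bound_var d = (\<lambda>e. Var (e - Suc d))"

definition pi :: "term_at \<Rightarrow> (term_at \<Rightarrow> term_at) \<Rightarrow> term_at" where
  "pi A B = (\<lambda>d. Pi (A d) (B (bound_var d) (Suc d)))"

definition lam :: "(term_at \<Rightarrow> term_at) \<Rightarrow> term_at" (binder \<open>\<^bold>\<lambda>\<close> 10) where
  "lam b = (\<lambda>d. Lam (b (bound_var d) (Suc d)))"

definition app :: "term_at \<Rightarrow> term_at \<Rightarrow> term_at" (infixl \<open>\<cdot>\<close> 90) where
  "f \<cdot> a = (\<lambda>d. App (f d) (a d))"

definition univ :: "nat \<Rightarrow> term_at" where
  "univ i = (\<lambda>d. U i)"

definition cst :: "const \<Rightarrow> term_at" (\<open>\<langle>_\<rangle>\<close>) where
  "\<langle>c\<rangle> = (\<lambda>d. Const c)"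

syntax "_pi" :: "pttrn \<Rightarrow> term_at \<Rightarrow> term_at \<Rightarrow> term_at" (\<open>(3\<^bold>\<Pi>_:_./ _)\<close> [0, 0, 10] 10)
translations "\<^bold>\<Pi>x:A. B" \<rightleftharpoons> "CONST pi A (\<lambda>x. B)"

definition arrow :: "term_at \<Rightarrow> term_at \<Rightarrow> term_at" (infixr \<open>\<^bold>\<rightarrow>\<close> 75) where
  "A \<^bold>\<rightarrow> B = (\<^bold>\<Pi>_:A. B)"

definition sigma :: "term_at \<Rightarrow> (term_at \<Rightarrow> term_at) \<Rightarrow> term_at" where
  "sigma A B = \<langle>cSigma\<rangle> \<cdot> A \<cdot> lam B"

syntax "_sigma" :: "pttrn \<Rightarrow> term_at \<Rightarrow> term_at \<Rightarrow> term_at" (\<open>(3\<^bold>\<Sigma>_:_./ _)\<close> [0, 0, 10] 10)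
translations "\<^bold>\<Sigma>x:A. B" \<rightleftharpoons> "CONST sigma A (\<lambda>x. B)"

definition times :: "term_at \<Rightarrow> term_at \<Rightarrow> term_at" (infixr \<open>\<^bold>\<times>\<close> 80) where
  "A \<^bold>\<times> B = (\<^bold>\<Sigma>_:A. B)"

definition pair :: "term_at \<Rightarrow> (term_at \<Rightarrow> term_at) \<Rightarrow> term_at \<Rightarrow> term_at \<Rightarrow> term_at" where
  "pair A B a b = \<langle>cPair\<rangle> \<cdot> A \<cdot> lam B \<cdot> a \<cdot> b"

text \<open>\<open>split_pair A B C (\<lambda>a b. t) p\<close> takes \<open>p : \<Sigma>x:A. B x\<close> apart, with result in the type \<open>C\<close>
  that does not depend on \<open>p\<close>.\<close>

definition split_pair ::
  "term_at \<Rightarrow> (term_at \<Rightarrow> term_at) \<Rightarrow> term_at \<Rightarrow> (term_at \<Rightarrow> term_at \<Rightarrow> term_at) \<Rightarrow> term_at \<Rightarrow> term_at" where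
  "split_pair A B C t p = \<langle>cIndSigma\<rangle> \<cdot> A \<cdot> lam B \<cdot> (\<^bold>\<lambda>_. C) \<cdot> (\<^bold>\<lambda>a. \<^bold>\<lambda>b. t a b) \<cdot> p"

definition first :: "term_at \<Rightarrow> (term_at \<Rightarrow> term_at) \<Rightarrow> term_at \<Rightarrow> term_at" where
  "first A B p = split_pair A B A (\<lambda>a b. a) p"

definition path :: "term_at \<Rightarrow> term_at \<Rightarrow> term_at \<Rightarrow> term_at" where
  "path A x y = \<langle>cId\<rangle> \<cdot> A \<cdot> x \<cdot> y"

definition refl_at :: "term_at \<Rightarrow> term_at \<Rightarrow> term_at" where
  "refl_at A x = \<langle>cRefl\<rangle> \<cdot> A \<cdot> x"


section \<open>Equivalences\<close>

definition is_equiv :: "term_at \<Rightarrow> term_at \<Rightarrow> term_at \<Rightarrow> term_at" where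
  "is_equiv A B f =
     (\<^bold>\<Sigma>g:B \<^bold>\<rightarrow> A. \<^bold>\<Pi>y:B. path B (f \<cdot> (g \<cdot> y)) y) \<^bold>\<times>
     (\<^bold>\<Sigma>h:B \<^bold>\<rightarrow> A. \<^bold>\<Pi>x:A. path A (h \<cdot> (f \<cdot> x)) x)"

definition equiv_type :: "term_at \<Rightarrow> term_at \<Rightarrow> term_at" where
  "equiv_type A B = (\<^bold>\<Sigma>f:A \<^bold>\<rightarrow> B. is_equiv A B f)"

definition id_equiv :: "term_at \<Rightarrow> term_at" where
  "id_equiv A =
     (let inverse = pair (A \<^bold>\<rightarrow> A) (\<lambda>g. \<^bold>\<Pi>x:A. path A (g \<cdot> x) x) (\<^bold>\<lambda>x. x) (\<^bold>\<lambda>x. refl_at A x);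
          inverse_type = (\<^bold>\<Sigma>g:A \<^bold>\<rightarrow> A. \<^bold>\<Pi>x:A. path A (g \<cdot> x) x)
      in pair (A \<^bold>\<rightarrow> A) (\<lambda>f. is_equiv A A f) (\<^bold>\<lambda>x. x)
           (pair inverse_type (\<lambda>_. inverse_type) inverse inverse))"

definition happly :: "term_at \<Rightarrow> term_at \<Rightarrow> term_at \<Rightarrow> term_at \<Rightarrow> term_at" where
  "happly A B f g = (\<^bold>\<lambda>p. \<langle>cIndId\<rangle> \<cdot> (\<^bold>\<Pi>x:A. B \<cdot> x)
     \<cdot> (\<^bold>\<lambda>f. \<^bold>\<lambda>g. \<^bold>\<lambda>_. \<^bold>\<Pi>x:A. path (B \<cdot> x) (f \<cdot> x) (g \<cdot> x))
     \<cdot> (\<^bold>\<lambda>f. \<^bold>\<lambda>x. refl_at (B \<cdot> x) (f \<cdot> x)) \<cdot> f \<cdot> g \<cdot> p)"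

definition id_to_equiv :: "nat \<Rightarrow> term_at \<Rightarrow> term_at \<Rightarrow> term_at" where
  "id_to_equiv i A B = (\<^bold>\<lambda>p. \<langle>cIndId\<rangle> \<cdot> univ i \<cdot> (\<^bold>\<lambda>A. \<^bold>\<lambda>B. \<^bold>\<lambda>_. equiv_type A B)
     \<cdot> (\<^bold>\<lambda>A. id_equiv A) \<cdot> A \<cdot> B \<cdot> p)"


section \<open>Types of the constants\<close>

abbreviation "NatT \<equiv> \<langle>cNat\<rangle>"
abbreviation "zero \<equiv> \<langle>cZero\<rangle>"
abbreviation "suc n \<equiv> \<langle>cSucc\<rangle> \<cdot> n"
abbreviation "Fin n \<equiv> \<langle>cFin\<rangle> \<cdot> n"
abbreviation "Ord m n \<equiv> \<langle>cOrd\<rangle> \<cdot> m \<cdot> n"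
abbreviation "ord0 \<equiv> \<langle>cOZero\<rangle>"
abbreviation "Sl m n f \<equiv> \<langle>cOSl\<rangle> \<cdot> m \<cdot> n \<cdot> f"
abbreviation "Sr m n f \<equiv> \<langle>cOSr\<rangle> \<cdot> m \<cdot> n \<cdot> f"

text \<open>Each constant is available at every universe level \<open>i\<close>; the level is not recorded in the term.
  All arguments of constants, including types and indices, are explicit.\<close>

fun const_type :: "const \<Rightarrow> nat \<Rightarrow> term_at" where
  "const_type cSigma i = (\<^bold>\<Pi>A:univ i. (A \<^bold>\<rightarrow> univ i) \<^bold>\<rightarrow> univ i)"
| "const_type cPair i =
     (\<^bold>\<Pi>A:univ i. \<^bold>\<Pi>B:A \<^bold>\<rightarrow> univ i. \<^bold>\<Pi>a:A. B \<cdot> a \<^bold>\<rightarrow> \<langle>cSigma\<rangle> \<cdot> A \<cdot> B)"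
| "const_type cIndSigma i =
     (\<^bold>\<Pi>A:univ i. \<^bold>\<Pi>B:A \<^bold>\<rightarrow> univ i. \<^bold>\<Pi>C:\<langle>cSigma\<rangle> \<cdot> A \<cdot> B \<^bold>\<rightarrow> univ i.
        (\<^bold>\<Pi>a:A. \<^bold>\<Pi>b:B \<cdot> a. C \<cdot> (\<langle>cPair\<rangle> \<cdot> A \<cdot> B \<cdot> a \<cdot> b)) \<^bold>\<rightarrow> (\<^bold>\<Pi>p:\<langle>cSigma\<rangle> \<cdot> A \<cdot> B. C \<cdot> p))"
| "const_type cSum i = univ i \<^bold>\<rightarrow> univ i \<^bold>\<rightarrow> univ i"
| "const_type cInl i = (\<^bold>\<Pi>A:univ i. \<^bold>\<Pi>B:univ i. A \<^bold>\<rightarrow> \<langle>cSum\<rangle> \<cdot> A \<cdot> B)"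
| "const_type cInr i = (\<^bold>\<Pi>A:univ i. \<^bold>\<Pi>B:univ i. B \<^bold>\<rightarrow> \<langle>cSum\<rangle> \<cdot> A \<cdot> B)"
| "const_type cIndSum i =
     (\<^bold>\<Pi>A:univ i. \<^bold>\<Pi>B:univ i. \<^bold>\<Pi>C:\<langle>cSum\<rangle> \<cdot> A \<cdot> B \<^bold>\<rightarrow> univ i.
        (\<^bold>\<Pi>a:A. C \<cdot> (\<langle>cInl\<rangle> \<cdot> A \<cdot> B \<cdot> a)) \<^bold>\<rightarrow> (\<^bold>\<Pi>b:B. C \<cdot> (\<langle>cInr\<rangle> \<cdot> A \<cdot> B \<cdot> b)) \<^bold>\<rightarrow>
        (\<^bold>\<Pi>s:\<langle>cSum\<rangle> \<cdot> A \<cdot> B. C \<cdot> s))"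
| "const_type cEmpty i = univ i"
| "const_type cIndEmpty i = (\<^bold>\<Pi>C:\<langle>cEmpty\<rangle> \<^bold>\<rightarrow> univ i. \<^bold>\<Pi>x:\<langle>cEmpty\<rangle>. C \<cdot> x)"
| "const_type cUnit i = univ i"
| "const_type cStar i = \<langle>cUnit\<rangle>"
| "const_type cIndUnit i =
     (\<^bold>\<Pi>C:\<langle>cUnit\<rangle> \<^bold>\<rightarrow> univ i. C \<cdot> \<langle>cStar\<rangle> \<^bold>\<rightarrow> (\<^bold>\<Pi>x:\<langle>cUnit\<rangle>. C \<cdot> x))"
| "const_type cNat i = univ i"
| "const_type cZero i = NatT"
| "const_type cSucc i = NatT \<^bold>\<rightarrow> NatT"
| "const_type cIndNat i =
     (\<^bold>\<Pi>C:NatT \<^bold>\<rightarrow> univ i. C \<cdot> zero \<^bold>\<rightarrow> (\<^bold>\<Pi>n:NatT. C \<cdot> n \<^bold>\<rightarrow> C \<cdot> suc n) \<^bold>\<rightarrow> (\<^bold>\<Pi>n:NatT. C \<cdot> n))"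
| "const_type cId i = (\<^bold>\<Pi>A:univ i. A \<^bold>\<rightarrow> A \<^bold>\<rightarrow> univ i)"
| "const_type cRefl i = (\<^bold>\<Pi>A:univ i. \<^bold>\<Pi>x:A. path A x x)"
| "const_type cIndId i =
     (\<^bold>\<Pi>A:univ i. \<^bold>\<Pi>C:(\<^bold>\<Pi>x:A. \<^bold>\<Pi>y:A. path A x y \<^bold>\<rightarrow> univ i).
        (\<^bold>\<Pi>x:A. C \<cdot> x \<cdot> x \<cdot> refl_at A x) \<^bold>\<rightarrow> (\<^bold>\<Pi>x:A. \<^bold>\<Pi>y:A. \<^bold>\<Pi>p:path A x y. C \<cdot> x \<cdot> y \<cdot> p))"
| "const_type cFin i = NatT \<^bold>\<rightarrow> univ i"
| "const_type cFZero i = (\<^bold>\<Pi>n:NatT. Fin (suc n))"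
| "const_type cFSucc i = (\<^bold>\<Pi>n:NatT. Fin n \<^bold>\<rightarrow> Fin (suc n))"
| "const_type cIndFin i =
     (\<^bold>\<Pi>C:(\<^bold>\<Pi>n:NatT. Fin n \<^bold>\<rightarrow> univ i).
        (\<^bold>\<Pi>n:NatT. C \<cdot> suc n \<cdot> (\<langle>cFZero\<rangle> \<cdot> n)) \<^bold>\<rightarrow>
        (\<^bold>\<Pi>n:NatT. \<^bold>\<Pi>k:Fin n. C \<cdot> n \<cdot> k \<^bold>\<rightarrow> C \<cdot> suc n \<cdot> (\<langle>cFSucc\<rangle> \<cdot> n \<cdot> k)) \<^bold>\<rightarrow>
        (\<^bold>\<Pi>n:NatT. \<^bold>\<Pi>k:Fin n. C \<cdot> n \<cdot> k))"
| "const_type cOrd i = NatT \<^bold>\<rightarrow> NatT \<^bold>\<rightarrow> univ i"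
| "const_type cOZero i = Ord zero zero"
| "const_type cOSl i = (\<^bold>\<Pi>m:NatT. \<^bold>\<Pi>n:NatT. Ord m (suc n) \<^bold>\<rightarrow> Ord (suc m) (suc n))"
| "const_type cOSr i = (\<^bold>\<Pi>m:NatT. \<^bold>\<Pi>n:NatT. Ord m n \<^bold>\<rightarrow> Ord m (suc n))"
| "const_type cIndOrd i =
     (\<^bold>\<Pi>C:(\<^bold>\<Pi>m:NatT. \<^bold>\<Pi>n:NatT. Ord m n \<^bold>\<rightarrow> univ i).
        C \<cdot> zero \<cdot> zero \<cdot> ord0 \<^bold>\<rightarrow>
        (\<^bold>\<Pi>m:NatT. \<^bold>\<Pi>n:NatT. \<^bold>\<Pi>f:Ord m (suc n). C \<cdot> m \<cdot> suc n \<cdot> f \<^bold>\<rightarrow> C \<cdot> suc m \<cdot> suc n \<cdot> Sl m n f) \<^bold>\<rightarrow>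
        (\<^bold>\<Pi>m:NatT. \<^bold>\<Pi>n:NatT. \<^bold>\<Pi>f:Ord m n. C \<cdot> m \<cdot> n \<cdot> f \<^bold>\<rightarrow> C \<cdot> m \<cdot> suc n \<cdot> Sr m n f) \<^bold>\<rightarrow>
        (\<^bold>\<Pi>m:NatT. \<^bold>\<Pi>n:NatT. \<^bold>\<Pi>f:Ord m n. C \<cdot> m \<cdot> n \<cdot> f))"
| "const_type cFunext i =
     (\<^bold>\<Pi>A:univ i. \<^bold>\<Pi>B:A \<^bold>\<rightarrow> univ i. \<^bold>\<Pi>f:(\<^bold>\<Pi>x:A. B \<cdot> x). \<^bold>\<Pi>g:(\<^bold>\<Pi>x:A. B \<cdot> x).
        is_equiv (path (\<^bold>\<Pi>x:A. B \<cdot> x) f g) (\<^bold>\<Pi>x:A. path (B \<cdot> x) (f \<cdot> x) (g \<cdot> x)) (happly A B f g))"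
| "const_type cUnivalence i =
     (\<^bold>\<Pi>A:univ i. \<^bold>\<Pi>B:univ i. is_equiv (path (univ i) A B) (equiv_type A B) (id_to_equiv i A B))"


section \<open>Convertibility and typing\<close>

abbreviation apps :: "const \<Rightarrow> tm list \<Rightarrow> tm" where
  "apps c ts \<equiv> foldl App (Const c) ts"

text \<open>Computation rules of the eliminators. On well-typed terms the type and index arguments that
  a rule discards are determined by the remaining ones.\<close>

inductive compute :: "tm \<Rightarrow> tm \<Rightarrow> bool" where
  "compute (apps cIndSigma [A, B, C, g, apps cPair [A', B', a, b]]) (App (App g a) b)"
| "compute (apps cIndSum [A, B, C, l, r, apps cInl [A', B', a]]) (App l a)"
| "compute (apps cIndSum [A, B, C, l, r, apps cInr [A', B', b]]) (App r b)"
| "compute (apps cIndUnit [C, c, Const cStar]) c"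
| "compute (apps cIndNat [C, z, s, Const cZero]) z"
| "compute (apps cIndNat [C, z, s, apps cSucc [n]]) (App (App s n) (apps cIndNat [C, z, s, n]))"
| "compute (apps cIndId [A, C, c, x, y, apps cRefl [A', a]]) (App c a)"
| "compute (apps cIndFin [C, z, s, k, apps cFZero [n]]) (App z n)"
| "compute (apps cIndFin [C, z, s, k, apps cFSucc [n, j]])
     (App (App (App s n) j) (apps cIndFin [C, z, s, n, j]))"
| "compute (apps cIndOrd [C, z, sl, sr, k, l, Const cOZero]) z"
| "compute (apps cIndOrd [C, z, sl, sr, k, l, apps cOSl [m, n, f]])
     (App (App (App (App sl m) n) f) (apps cIndOrd [C, z, sl, sr, m, apps cSucc [n], f]))"
| "compute (apps cIndOrd [C, z, sl, sr, k, l, apps cOSr [m, n, f]])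
     (App (App (App (App sr m) n) f) (apps cIndOrd [C, z, sl, sr, m, n, f]))"

inductive conv :: "tm \<Rightarrow> tm \<Rightarrow> bool" (infix \<open>\<approx>\<close> 50) where
  conv_refl: "t \<approx> t"
| conv_sym: "t \<approx> u \<Longrightarrow> u \<approx> t"
| conv_trans: "t \<approx> u \<Longrightarrow> u \<approx> v \<Longrightarrow> t \<approx> v"
| conv_Pi: "A \<approx> A' \<Longrightarrow> B \<approx> B' \<Longrightarrow> Pi A B \<approx> Pi A' B'"
| conv_Lam: "b \<approx> b' \<Longrightarrow> Lam b \<approx> Lam b'"
| conv_App: "f \<approx> f' \<Longrightarrow> a \<approx> a' \<Longrightarrow> App f a \<approx> App f' a'"
| conv_beta: "App (Lam b) a \<approx> subst 0 a b"
| conv_eta: "Lam (App (lift 0 f) (Var 0)) \<approx> f"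
| conv_compute: "compute t u \<Longrightarrow> t \<approx> u"

text \<open>Contexts are lists of types, the most recent variable first.\<close>

inductive ctx :: "tm list \<Rightarrow> bool" and has_type :: "tm list \<Rightarrow> tm \<Rightarrow> tm \<Rightarrow> bool" where
  ctx_Nil: "ctx []"
| ctx_Cons: "ctx \<Gamma> \<Longrightarrow> has_type \<Gamma> A (U i) \<Longrightarrow> ctx (A # \<Gamma>)"
| type_Var: "ctx \<Gamma> \<Longrightarrow> n < length \<Gamma> \<Longrightarrow> has_type \<Gamma> (Var n) ((lift 0 ^^ Suc n) (\<Gamma> ! n))"
| type_U: "ctx \<Gamma> \<Longrightarrow> has_type \<Gamma> (U i) (U (Suc i))"
| type_cumulative: "has_type \<Gamma> A (U i) \<Longrightarrow> has_type \<Gamma> A (U (Suc i))"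
| type_Pi: "has_type \<Gamma> A (U i) \<Longrightarrow> has_type (A # \<Gamma>) B (U i) \<Longrightarrow> has_type \<Gamma> (Pi A B) (U i)"
| type_Lam: "has_type (A # \<Gamma>) b B \<Longrightarrow> has_type \<Gamma> (Lam b) (Pi A B)"
| type_App: "has_type \<Gamma> f (Pi A B) \<Longrightarrow> has_type \<Gamma> a A \<Longrightarrow> has_type \<Gamma> (App f a) (subst 0 a B)"
| type_Const: "ctx \<Gamma> \<Longrightarrow> has_type \<Gamma> (Const c) (const_type c i 0)"
| type_conv: "has_type \<Gamma> t A \<Longrightarrow> A \<approx> B \<Longrightarrow> has_type \<Gamma> B (U i) \<Longrightarrow> has_type \<Gamma> t B"

definition inhabited :: "term_at \<Rightarrow> bool" where
  "inhabited A \<longleftrightarrow> (\<exists>t. has_type [] t (A 0))"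


section \<open>1-concrete categories\<close>

definition fibre :: "term_at \<Rightarrow> term_at \<Rightarrow> term_at \<Rightarrow> term_at \<Rightarrow> term_at" where
  "fibre A B f b = (\<^bold>\<Sigma>a:A. path B (f \<cdot> a) b)"

text \<open>\<open>truncated k A\<close> says that \<open>A\<close> is a \<open>(k - 2)\<close>-truncated type.\<close>

primrec truncated :: "nat \<Rightarrow> term_at \<Rightarrow> term_at" where
  "truncated 0 A = (\<^bold>\<Sigma>c:A. \<^bold>\<Pi>x:A. path A c x)"
| "truncated (Suc k) A = (\<^bold>\<Pi>x:A. \<^bold>\<Pi>y:A. truncated k (path A x y))"

definition truncated_map :: "nat \<Rightarrow> term_at \<Rightarrow> term_at \<Rightarrow> term_at \<Rightarrow> term_at" where
  "truncated_map k A B f = (\<^bold>\<Pi>b:B. truncated k (fibre A B f b))"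

text \<open>The universe called \<open>Type\<close> is \<open>univ l\<close>, for an arbitrary level \<open>l\<close>. The nested \<open>\<Sigma>\<close>-type of
  1-concrete categories is split up after each component because the projections refer to the
  types of the remaining components.\<close>

definition ident'_type :: "term_at \<Rightarrow> term_at \<Rightarrow> term_at \<Rightarrow> term_at \<Rightarrow> term_at" where
  "ident'_type obj objp hom homp =
     (\<^bold>\<Pi>x:obj. fibre (hom \<cdot> x \<cdot> x) (objp \<cdot> x \<^bold>\<rightarrow> objp \<cdot> x) (homp \<cdot> x \<cdot> x) (\<^bold>\<lambda>a. a))"

definition cmp'_type :: "term_at \<Rightarrow> term_at \<Rightarrow> term_at \<Rightarrow> term_at \<Rightarrow> term_at" where
  "cmp'_type obj objp hom homp =
     (\<^bold>\<Pi>x:obj. \<^bold>\<Pi>y:obj. \<^bold>\<Pi>z:obj. \<^bold>\<Pi>g:hom \<cdot> y \<cdot> z. \<^bold>\<Pi>f:hom \<cdot> x \<cdot> y.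
        fibre (hom \<cdot> x \<cdot> z) (objp \<cdot> x \<^bold>\<rightarrow> objp \<cdot> z) (homp \<cdot> x \<cdot> z)
          (\<^bold>\<lambda>a. homp \<cdot> y \<cdot> z \<cdot> g \<cdot> (homp \<cdot> x \<cdot> y \<cdot> f \<cdot> a)))"

definition conf_type :: "term_at \<Rightarrow> term_at \<Rightarrow> term_at \<Rightarrow> term_at \<Rightarrow> term_at" where
  "conf_type obj objp hom homp =
     (\<^bold>\<Pi>x:obj. \<^bold>\<Pi>y:obj. truncated_map 1 (hom \<cdot> x \<cdot> y) (objp \<cdot> x \<^bold>\<rightarrow> objp \<cdot> y) (homp \<cdot> x \<cdot> y))"

definition homp_type :: "term_at \<Rightarrow> term_at \<Rightarrow> term_at \<Rightarrow> term_at" where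
  "homp_type obj objp hom = (\<^bold>\<Pi>x:obj. \<^bold>\<Pi>y:obj. hom \<cdot> x \<cdot> y \<^bold>\<rightarrow> (objp \<cdot> x \<^bold>\<rightarrow> objp \<cdot> y))"

definition from_conf :: "term_at \<Rightarrow> term_at \<Rightarrow> term_at \<Rightarrow> term_at \<Rightarrow> term_at" where
  "from_conf obj objp hom homp =
     (\<^bold>\<Sigma>_:conf_type obj objp hom homp. ident'_type obj objp hom homp \<^bold>\<times> cmp'_type obj objp hom homp)"

definition from_homp :: "term_at \<Rightarrow> term_at \<Rightarrow> term_at \<Rightarrow> term_at" where
  "from_homp obj objp hom = (\<^bold>\<Sigma>homp:homp_type obj objp hom. from_conf obj objp hom homp)"

definition from_hom :: "nat \<Rightarrow> term_at \<Rightarrow> term_at \<Rightarrow> term_at" where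
  "from_hom l obj objp = (\<^bold>\<Sigma>hom:obj \<^bold>\<rightarrow> obj \<^bold>\<rightarrow> univ l. from_homp obj objp hom)"

definition from_objp :: "nat \<Rightarrow> term_at \<Rightarrow> term_at" where
  "from_objp l obj = (\<^bold>\<Sigma>objp:obj \<^bold>\<rightarrow> univ l. from_hom l obj objp)"

definition concrete_cat :: "nat \<Rightarrow> term_at" where
  "concrete_cat l = (\<^bold>\<Sigma>obj:univ l. from_objp l obj)"


section \<open>Underlying categorical data\<close>

definition ident_type :: "term_at \<Rightarrow> term_at \<Rightarrow> term_at" where
  "ident_type obj hom = (\<^bold>\<Pi>x:obj. hom \<cdot> x \<cdot> x)"

definition cmp_type :: "term_at \<Rightarrow> term_at \<Rightarrow> term_at" where
  "cmp_type obj hom =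
     (\<^bold>\<Pi>x:obj. \<^bold>\<Pi>y:obj. \<^bold>\<Pi>z:obj. hom \<cdot> y \<cdot> z \<^bold>\<rightarrow> hom \<cdot> x \<cdot> y \<^bold>\<rightarrow> hom \<cdot> x \<cdot> z)"

definition cat_data :: "nat \<Rightarrow> term_at" where
  "cat_data l =
     (\<^bold>\<Sigma>obj:univ l. \<^bold>\<Sigma>hom:obj \<^bold>\<rightarrow> obj \<^bold>\<rightarrow> univ l. ident_type obj hom \<^bold>\<times> cmp_type obj hom)"

definition mk_cat_data :: "nat \<Rightarrow> term_at \<Rightarrow> term_at \<Rightarrow> term_at \<Rightarrow> term_at \<Rightarrow> term_at" where
  "mk_cat_data l obj hom ident cmp =
     pair (univ l) (\<lambda>obj. \<^bold>\<Sigma>hom:obj \<^bold>\<rightarrow> obj \<^bold>\<rightarrow> univ l. ident_type obj hom \<^bold>\<times> cmp_type obj hom) obj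
       (pair (obj \<^bold>\<rightarrow> obj \<^bold>\<rightarrow> univ l) (\<lambda>hom. ident_type obj hom \<^bold>\<times> cmp_type obj hom) hom
         (pair (ident_type obj hom) (\<lambda>_. cmp_type obj hom) ident cmp))"

definition ident_of :: "term_at \<Rightarrow> term_at \<Rightarrow> term_at \<Rightarrow> term_at \<Rightarrow> term_at" where
  "ident_of objp hom homp ident' =
     (\<^bold>\<lambda>x. first (hom \<cdot> x \<cdot> x)
        (\<lambda>h. path (objp \<cdot> x \<^bold>\<rightarrow> objp \<cdot> x) (homp \<cdot> x \<cdot> x \<cdot> h) (\<^bold>\<lambda>a. a)) (ident' \<cdot> x))"

definition cmp_of :: "term_at \<Rightarrow> term_at \<Rightarrow> term_at \<Rightarrow> term_at \<Rightarrow> term_at" where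
  "cmp_of objp hom homp cmp' =
     (\<^bold>\<lambda>x. \<^bold>\<lambda>y. \<^bold>\<lambda>z. \<^bold>\<lambda>g. \<^bold>\<lambda>f. first (hom \<cdot> x \<cdot> z)
        (\<lambda>h. path (objp \<cdot> x \<^bold>\<rightarrow> objp \<cdot> z) (homp \<cdot> x \<cdot> z \<cdot> h)
           (\<^bold>\<lambda>a. homp \<cdot> y \<cdot> z \<cdot> g \<cdot> (homp \<cdot> x \<cdot> y \<cdot> f \<cdot> a)))
        (cmp' \<cdot> x \<cdot> y \<cdot> z \<cdot> g \<cdot> f))"

definition underlying :: "nat \<Rightarrow> term_at \<Rightarrow> term_at" where
  "underlying l C =
     split_pair (univ l) (\<lambda>obj. from_objp l obj) (cat_data l) (\<lambda>obj r.
     split_pair (obj \<^bold>\<rightarrow> univ l) (\<lambda>objp. from_hom l obj objp) (cat_data l) (\<lambda>objp r.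
     split_pair (obj \<^bold>\<rightarrow> obj \<^bold>\<rightarrow> univ l) (\<lambda>hom. from_homp obj objp hom) (cat_data l) (\<lambda>hom r.
     split_pair (homp_type obj objp hom) (\<lambda>homp. from_conf obj objp hom homp) (cat_data l) (\<lambda>homp r.
     split_pair (conf_type obj objp hom homp)
       (\<lambda>_. ident'_type obj objp hom homp \<^bold>\<times> cmp'_type obj objp hom homp) (cat_data l) (\<lambda>conf r.
     split_pair (ident'_type obj objp hom homp) (\<lambda>_. cmp'_type obj objp hom homp) (cat_data l)
       (\<lambda>ident' cmp'. mk_cat_data l obj hom (ident_of objp hom homp ident') (cmp_of objp hom homp cmp'))
     r) r) r) r) r) C"


section \<open>The simplex category\<close>

definition ord_id :: term_at where
  "ord_id = \<langle>cIndNat\<rangle> \<cdot> (\<^bold>\<lambda>n. Ord n n) \<cdot> ord0 \<cdot> (\<^bold>\<lambda>n. \<^bold>\<lambda>i. Sl n n (Sr n n i))"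

text \<open>
  Composition \<open>g \<circ> f\<close> is defined by induction on \<open>g : Ord m n\<close>, with an inner induction on \<open>f\<close> when
  \<open>g = S\<^sup>l g'\<close>. The inner motive quantifies over \<open>comp : \<Pi>p. Ord p (pred b) \<rightarrow> Ord p (n + 1)\<close>, to be
  instantiated by composition with \<open>g'\<close>, where \<open>b\<close> is the codomain of \<open>f\<close>;
  the case \<open>f = 0\<close>, where \<open>b = 0\<close>, does not occur in the instantiation.
  The resulting recursion equations are the lemmas \<open>ord_id_zero\<close>, \<open>ord_id_suc\<close>, \<open>ord_comp_ord0\<close>,
  \<open>ord_comp_Sr\<close>, \<open>ord_comp_Sl_Sr\<close> and \<open>ord_comp_Sl_Sl\<close> below.
\<close>

definition nat_pred :: term_at where
  "nat_pred = \<langle>cIndNat\<rangle> \<cdot> (\<^bold>\<lambda>_. NatT) \<cdot> zero \<cdot> (\<^bold>\<lambda>n. \<^bold>\<lambda>_. n)"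

definition ord_comp_Sl :: term_at where
  "ord_comp_Sl = (\<^bold>\<lambda>n. \<langle>cIndOrd\<rangle>
     \<cdot> (\<^bold>\<lambda>a. \<^bold>\<lambda>b. \<^bold>\<lambda>_. (\<^bold>\<Pi>p:NatT. Ord p (nat_pred \<cdot> b) \<^bold>\<rightarrow> Ord p (suc n)) \<^bold>\<rightarrow> Ord a (suc n))
     \<cdot> (\<^bold>\<lambda>comp. comp \<cdot> zero \<cdot> ord0)
     \<cdot> (\<^bold>\<lambda>a. \<^bold>\<lambda>b. \<^bold>\<lambda>f. \<^bold>\<lambda>rec. \<^bold>\<lambda>comp. Sl a n (rec \<cdot> comp))
     \<cdot> (\<^bold>\<lambda>a. \<^bold>\<lambda>b. \<^bold>\<lambda>f. \<^bold>\<lambda>_. \<^bold>\<lambda>comp. comp \<cdot> a \<cdot> f))"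

definition ord_comp_rec :: term_at where
  "ord_comp_rec = \<langle>cIndOrd\<rangle>
     \<cdot> (\<^bold>\<lambda>m. \<^bold>\<lambda>n. \<^bold>\<lambda>_. \<^bold>\<Pi>p:NatT. Ord p m \<^bold>\<rightarrow> Ord p n)
     \<cdot> (\<^bold>\<lambda>p. \<^bold>\<lambda>f. f)
     \<cdot> (\<^bold>\<lambda>m. \<^bold>\<lambda>n. \<^bold>\<lambda>g. \<^bold>\<lambda>comp. \<^bold>\<lambda>p. \<^bold>\<lambda>f. ord_comp_Sl \<cdot> n \<cdot> p \<cdot> suc m \<cdot> f \<cdot> comp)
     \<cdot> (\<^bold>\<lambda>m. \<^bold>\<lambda>n. \<^bold>\<lambda>g. \<^bold>\<lambda>comp. \<^bold>\<lambda>p. \<^bold>\<lambda>f. Sr p n (comp \<cdot> p \<cdot> f))"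

definition ord_comp :: term_at where
  "ord_comp = (\<^bold>\<lambda>l. \<^bold>\<lambda>m. \<^bold>\<lambda>n. \<^bold>\<lambda>g. \<^bold>\<lambda>f. ord_comp_rec \<cdot> m \<cdot> n \<cdot> g \<cdot> l \<cdot> f)"

definition simplex_data :: "nat \<Rightarrow> term_at" where
  "simplex_data l = mk_cat_data l NatT
     (\<^bold>\<lambda>m. \<^bold>\<lambda>n. Ord (suc m) (suc n))
     (\<^bold>\<lambda>n. ord_id \<cdot> suc n)
     (\<^bold>\<lambda>x. \<^bold>\<lambda>y. \<^bold>\<lambda>z. \<^bold>\<lambda>g. \<^bold>\<lambda>f. ord_comp \<cdot> suc x \<cdot> suc y \<cdot> suc z \<cdot> g \<cdot> f)"


subsection \<open>Recursion equations for identities and composition\<close>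

lemma lift_lift: "i \<le> k \<Longrightarrow> lift i (lift k t) = lift (Suc k) (lift i t)"
  by (induction t arbitrary: i k) auto

lemma subst_lift: "subst k u (lift k t) = t"
  by (induction t arbitrary: k u) auto

lemma subst_lift_le: "i \<le> k \<Longrightarrow> subst (Suc k) (lift i u) (lift i t) = lift i (subst k u t)"
  by (induction t arbitrary: i k u) (auto simp: lift_lift[where i = 0])

lemma lift_funpow: "lift k ((lift 0 ^^ k) t) = (lift 0 ^^ Suc k) t"
  by (induction k) (simp_all flip: lift_lift[of 0, simplified])

lemma subst_lift_funpow: "subst k u ((lift 0 ^^ Suc k) t) = (lift 0 ^^ k) t"
  by (metis lift_funpow subst_lift)

declare conv_trans [trans]

lemma conv_apps: "f \<approx> g \<Longrightarrow> foldl App f as \<approx> foldl App g as"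
  by (induction as arbitrary: f g) (auto intro: conv_App conv_refl)

lemma beta_step: "foldl App (subst 0 a b) as \<approx> u \<Longrightarrow> foldl App (Lam b) (a # as) \<approx> u"
  using conv_apps[OF conv_beta, of b a as] by (auto intro: conv_trans)

lemma compute_step: "compute t t' \<Longrightarrow> foldl App t' as \<approx> u \<Longrightarrow> foldl App t as \<approx> u"
  using conv_apps[OF conv_compute, of t t' as] by (auto intro: conv_trans)

lemma compute_step_3:
  "compute (foldl App t [x, y, z]) t' \<Longrightarrow> foldl App t' as \<approx> u \<Longrightarrow> foldl App t (x # y # z # as) \<approx> u"
  using compute_step[of "foldl App t [x, y, z]"] by simp

lemmas term_at_defs = pi_def lam_def app_def cst_def bound_var_def arrow_def

lemma closed_terms:
  "NO_MATCH 0 d \<Longrightarrow> nat_pred d = nat_pred 0"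
  "lift k (nat_pred 0) = nat_pred 0"
  "subst k u (nat_pred 0) = nat_pred 0"
  "NO_MATCH 0 d \<Longrightarrow> ord_comp_Sl d = ord_comp_Sl 0"
  "lift k (ord_comp_Sl 0) = ord_comp_Sl 0"
  "subst k u (ord_comp_Sl 0) = ord_comp_Sl 0"
  "NO_MATCH 0 d \<Longrightarrow> ord_comp_rec d = ord_comp_rec 0"
  "lift k (ord_comp_rec 0) = ord_comp_rec 0"
  "subst k u (ord_comp_rec 0) = ord_comp_rec 0"
  by (simp_all add: ord_comp_rec_def ord_comp_Sl_def nat_pred_def term_at_defs)

lemmas subst_simps = closed_terms subst_lift subst_lift_le[of 0, simplified]
  subst_lift_funpow[of "Suc 0", simplified]
  subst_lift_funpow[of "Suc (Suc 0)", simplified]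

lemma ord_comp_unfold:
  "(ord_comp \<cdot> l \<cdot> m \<cdot> n \<cdot> g \<cdot> f) d \<approx> (ord_comp_rec \<cdot> m \<cdot> n \<cdot> g \<cdot> l \<cdot> f) d"
proof -
  have "foldl App (ord_comp d) [l d, m d, n d, g d, f d] \<approx> (ord_comp_rec \<cdot> m \<cdot> n \<cdot> g \<cdot> l \<cdot> f) d"
    by (simp add: ord_comp_def term_at_defs closed_terms del: foldl.simps,
        (rule beta_step, simp add: subst_simps del: foldl.simps)+)
       (simp add: conv_refl)
  then show ?thesis by (simp add: app_def)
qed

lemma ord_comp_rec_ord0: "(ord_comp_rec \<cdot> m \<cdot> n \<cdot> ord0 \<cdot> l \<cdot> f) d \<approx> f d"
proof -
  have "foldl App ((ord_comp_rec \<cdot> m \<cdot> n \<cdot> ord0) d) [l d, f d] \<approx> f d"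
    by (simp add: ord_comp_rec_def term_at_defs closed_terms del: foldl.simps,
        rule compute_step, rule compute.intros(10)[simplified],
        (rule beta_step, simp del: foldl.simps)+)
       (simp add: conv_refl)
  then show ?thesis by (simp add: app_def)
qed

lemma ord_comp_rec_Sr:
  "(ord_comp_rec \<cdot> m \<cdot> suc n \<cdot> Sr m n g \<cdot> l \<cdot> f) d \<approx> (Sr l n (ord_comp_rec \<cdot> m \<cdot> n \<cdot> g \<cdot> l \<cdot> f)) d"
proof -
  have "foldl App ((ord_comp_rec \<cdot> m \<cdot> suc n \<cdot> Sr m n g) d) [l d, f d]
    \<approx> (Sr l n (ord_comp_rec \<cdot> m \<cdot> n \<cdot> g \<cdot> l \<cdot> f)) d"
    by (simp add: ord_comp_rec_def term_at_defs closed_terms del: foldl.simps,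
        rule compute_step, rule compute.intros(12)[simplified],
        simp only: foldl.simps(2)[symmetric],
        (rule beta_step, simp add: subst_simps del: foldl.simps)+)
       (simp add: conv_refl)
  then show ?thesis by (simp add: app_def)
qed

lemma ord_comp_rec_Sl:
  "(ord_comp_rec \<cdot> suc m \<cdot> suc n \<cdot> Sl m n g \<cdot> l \<cdot> f) d
    \<approx> (ord_comp_Sl \<cdot> n \<cdot> l \<cdot> suc m \<cdot> f \<cdot> (ord_comp_rec \<cdot> m \<cdot> suc n \<cdot> g)) d"
proof -
  have "foldl App ((ord_comp_rec \<cdot> suc m \<cdot> suc n \<cdot> Sl m n g) d) [l d, f d]
     \<approx> (ord_comp_Sl \<cdot> n \<cdot> l \<cdot> suc m \<cdot> f \<cdot> (ord_comp_rec \<cdot> m \<cdot> suc n \<cdot> g)) d"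
    by (simp add: ord_comp_rec_def term_at_defs closed_terms del: foldl.simps,
        rule compute_step, rule compute.intros(11)[simplified],
        simp only: foldl.simps(2)[symmetric],
        (rule beta_step, simp add: subst_simps del: foldl.simps)+)
       (simp add: conv_refl)
  then show ?thesis by (simp add: app_def)
qed

lemma ord_comp_Sl_at_Sr: "(ord_comp_Sl \<cdot> n \<cdot> l \<cdot> suc m \<cdot> Sr l m f \<cdot> c) d \<approx> (c \<cdot> l \<cdot> f) d"
proof -
  have "foldl App (ord_comp_Sl d) [n d, l d, (suc m) d, (Sr l m f) d, c d] \<approx> (c \<cdot> l \<cdot> f) d"
    by (simp add: ord_comp_Sl_def term_at_defs closed_terms del: foldl.simps,
        rule beta_step, simp add: subst_simps del: foldl.simps,
        rule compute_step_3, simp, rule compute.intros(12)[simplified],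
        simp only: foldl.simps(2)[symmetric],
        (rule beta_step, simp add: subst_simps del: foldl.simps)+)
       (simp add: conv_refl)
  then show ?thesis by (simp add: app_def)
qed

lemma ord_comp_Sl_at_Sl:
  "(ord_comp_Sl \<cdot> n \<cdot> suc l \<cdot> suc m \<cdot> Sl l m f \<cdot> c) d \<approx> (Sl l n (ord_comp_Sl \<cdot> n \<cdot> l \<cdot> suc m \<cdot> f \<cdot> c)) d"
proof -
  define b where "b = (case ord_comp_Sl 0 of Lam b \<Rightarrow> b)"
  have b: "ord_comp_Sl 0 = Lam b"
    by (simp add: b_def ord_comp_Sl_def lam_def)
  let ?ind = "\<lambda>as. foldl App (subst 0 (n d) b) as"
  have ind: "?ind (a # as) \<approx> foldl App (ord_comp_Sl d) (n d # a # as)" for a as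
    by (rule conv_sym) (simp add: b closed_terms del: foldl.simps, rule beta_step, rule conv_refl)
  have "?ind [(suc l) d, (suc m) d, (Sl l m f) d, c d]
    \<approx> App (App (App (Const cOSl) (l d)) (n d)) (?ind [l d, (suc m) d, f d, c d])"
    by (simp add: b_def ord_comp_Sl_def term_at_defs closed_terms subst_simps del: foldl.simps,
        rule compute_step_3, simp, rule compute.intros(11)[simplified],
        simp only: foldl.simps(2)[symmetric],
        (rule beta_step, simp add: subst_simps del: foldl.simps)+)
       (simp add: conv_refl)
  also have "\<dots> \<approx> (Sl l n (ord_comp_Sl \<cdot> n \<cdot> l \<cdot> suc m \<cdot> f \<cdot> c)) d"
    using ind[of "l d" "[(suc m) d, f d, c d]"]
    by (simp add: app_def cst_def conv_App conv_refl)
  finally show ?thesis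
    using ind[of "(suc l) d" "[(suc m) d, (Sl l m f) d, c d]"]
    by (auto simp: app_def intro: conv_trans conv_sym)
qed

lemma ord_id_suc: "(ord_id \<cdot> suc n) d \<approx> (Sl n n (Sr n n (ord_id \<cdot> n))) d"
proof -
  have "foldl App ((ord_id \<cdot> suc n) d) [] \<approx> (Sl n n (Sr n n (ord_id \<cdot> n))) d"
    by (simp add: ord_id_def term_at_defs del: foldl.simps,
        rule compute_step, rule compute.intros(6)[simplified],
        simp only: foldl.simps(2)[symmetric],
        (rule beta_step, simp add: subst_simps del: foldl.simps)+)
       (simp add: conv_refl)
  then show ?thesis by simp
qed

lemma ord_id_zero: "(ord_id \<cdot> zero) d \<approx> ord0 d"
  by (simp add: ord_id_def term_at_defs conv_compute compute.intros(5)[simplified])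

lemma ord_comp_ord0: "(ord_comp \<cdot> l \<cdot> zero \<cdot> zero \<cdot> ord0 \<cdot> f) d \<approx> f d"
  using ord_comp_unfold ord_comp_rec_ord0 by (rule conv_trans)

lemma ord_comp_Sr:
  "(ord_comp \<cdot> l \<cdot> m \<cdot> suc n \<cdot> Sr m n g \<cdot> f) d \<approx> (Sr l n (ord_comp \<cdot> l \<cdot> m \<cdot> n \<cdot> g \<cdot> f)) d"
proof -
  have "(Sr l n (ord_comp_rec \<cdot> m \<cdot> n \<cdot> g \<cdot> l \<cdot> f)) d \<approx> (Sr l n (ord_comp \<cdot> l \<cdot> m \<cdot> n \<cdot> g \<cdot> f)) d"
    using conv_App[OF conv_refl conv_sym[OF ord_comp_unfold]] by (simp add: app_def)
  then show ?thesis
    by (rule conv_trans[OF conv_trans[OF ord_comp_unfold ord_comp_rec_Sr]])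
qed

lemma ord_comp_Sl_Sr:
  "(ord_comp \<cdot> l \<cdot> suc m \<cdot> suc n \<cdot> Sl m n g \<cdot> Sr l m f) d \<approx> (ord_comp \<cdot> l \<cdot> m \<cdot> suc n \<cdot> g \<cdot> f) d"
  by (intro conv_trans[OF ord_comp_unfold] conv_trans[OF ord_comp_rec_Sl]
      conv_trans[OF ord_comp_Sl_at_Sr] conv_sym[OF ord_comp_unfold])

lemma ord_comp_Sl_Sl:
  "(ord_comp \<cdot> suc l \<cdot> suc m \<cdot> suc n \<cdot> Sl m n g \<cdot> Sl l m f) d
    \<approx> (Sl l n (ord_comp \<cdot> l \<cdot> suc m \<cdot> suc n \<cdot> Sl m n g \<cdot> f)) d"
proof -
  have "(Sl l n (ord_comp_Sl \<cdot> n \<cdot> l \<cdot> suc m \<cdot> f \<cdot> (ord_comp_rec \<cdot> m \<cdot> suc n \<cdot> g))) d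
    \<approx> (Sl l n (ord_comp \<cdot> l \<cdot> suc m \<cdot> suc n \<cdot> Sl m n g \<cdot> f)) d"
    using conv_App[OF conv_refl conv_sym[OF conv_trans[OF ord_comp_unfold ord_comp_rec_Sl]]]
    by (simp add: app_def)
  then show ?thesis
    by (intro conv_trans[OF ord_comp_unfold] conv_trans[OF ord_comp_rec_Sl] conv_trans[OF ord_comp_Sl_at_Sl])
qed

end

theory Submission
  imports Defs
begin

text \<open>
  Let \<open>points 0 = 0\<close> and \<open>points (n + 1) = 1 + points n\<close>, and realise the object \<open>n\<close> of the simplex
  category as \<open>points (n + 1)\<close>. A term of \<open>Ord m n\<close> acts as a function \<open>points m \<rightarrow> points n\<close>, and
  this action has a left inverse \<open>unact\<close>, defined by recursion on \<open>m\<close> and \<open>n\<close>: the value at the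
  least point says whether the map was built by \<open>S\<^sup>l\<close> or \<open>S\<^sup>r\<close>. Since \<open>points n\<close> is a set, so is
  \<open>points m \<rightarrow> points n\<close>, and a map into a set that has a left inverse has propositional fibres. The
  action respects identities and composition by induction on \<open>Ord\<close>, and the underlying categorical
  data is convertible to that of the simplex category, so that the required path is reflexivity.

  The typing derivations are found by a type checker that is proved sound and evaluated by the
  simplifier. It works at universe level 0; level \<open>l\<close> follows by shifting all universes.
\<close>

section \<open>A type checker\<close>

text \<open>
  Iterated \<open>lift\<close> and \<open>subst\<close> traverse their argument once per binder. \<open>shift\<close> and \<open>inst\<close> are
  one-pass versions, which keeps the symbolic evaluation of the checker affordable.
\<close>

primrec shift :: "nat \<Rightarrow> nat \<Rightarrow> tm \<Rightarrow> tm" where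
  "shift n k (Var i) = Var (if i < k then i else i + n)"
| "shift n k (U i) = U i"
| "shift n k (Pi A B) = Pi (shift n k A) (shift n (Suc k) B)"
| "shift n k (Lam b) = Lam (shift n (Suc k) b)"
| "shift n k (App f a) = App (shift n k f) (shift n k a)"
| "shift n k (Const c) = Const c"

lemma shift_eq_lift: "shift n k t = (lift k ^^ n) t"
proof (induction n)
  case 0
  show ?case by (induction t arbitrary: k) auto
next
  case (Suc n)
  have "shift (Suc n) k t = lift k (shift n k t)"
    by (induction t arbitrary: k) auto
  then show ?case using Suc by simp
qed

primrec inst :: "nat \<Rightarrow> tm \<Rightarrow> tm \<Rightarrow> tm" where
  "inst k u (Var n) = (if n < k then Var n else if n = k then
    (if k = 0 then u else shift k 0 u) else Var (n - 1))"
| "inst k u (U i) = U i"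
| "inst k u (Pi A B) = Pi (inst k u A) (inst (Suc k) u B)"
| "inst k u (Lam b) = Lam (inst (Suc k) u b)"
| "inst k u (App f a) = App (inst k u f) (inst k u a)"
| "inst k u (Const c) = Const c"

lemma inst_eq_subst: "inst k u t = subst k ((lift 0 ^^ k) u) t"
  by (induction t arbitrary: k) (auto simp: shift_eq_lift)

lemma inst_0: "inst 0 u t = subst 0 u t"
  by (simp add: inst_eq_subst)

text \<open>Written with conditionals so that symbolic evaluation can stop at the first
  mismatch.\<close>

primrec same :: "tm \<Rightarrow> tm \<Rightarrow> bool" where
  "same (Var i) u = (case u of Var j \<Rightarrow> i = j | _ \<Rightarrow> False)"
| "same (U i) u = (case u of U j \<Rightarrow> i = j | _ \<Rightarrow> False)"
| "same (Pi A B) u = (case u of Pi A' B' \<Rightarrow> if same A A' then same B B' else False | _ \<Rightarrow> False)"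
| "same (Lam b) u = (case u of Lam b' \<Rightarrow> same b b' | _ \<Rightarrow> False)"
| "same (App f a) u = (case u of App f' a' \<Rightarrow> if same f f' then same a a' else False | _ \<Rightarrow> False)"
| "same (Const c) u = (case u of Const d \<Rightarrow> c = d | _ \<Rightarrow> False)"

lemma same_iff: "same t u \<longleftrightarrow> t = u"
  by (induction t arbitrary: u) (auto split: tm.splits)

primrec lookup :: "(tm \<times> tm) list \<Rightarrow> tm \<Rightarrow> tm option" where
  "lookup [] t = None"
| "lookup (p # ps) t = (if same (fst p) t then Some (snd p) else lookup ps t)"

lemma lookup_SomeD: "lookup ps t = Some T \<Longrightarrow> (t, T) \<in> set ps"
  by (induction ps) (auto simp: same_iff split: if_splits)

section \<open>Weak head reduction and the conversion test\<close>

fun strip :: "tm \<Rightarrow> tm list \<Rightarrow> (const \<times> tm list) option" where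
  "strip (App f a) as = strip f (a # as)"
| "strip (Const c) as = Some (c, as)"
| "strip _ as = None"

definition scrutinee :: "const \<Rightarrow> nat option" where
  "scrutinee c = (case c of cIndSigma \<Rightarrow> Some 4 | cIndSum \<Rightarrow> Some 5 | cIndUnit \<Rightarrow> Some 2
     | cIndNat \<Rightarrow> Some 3 | cIndId \<Rightarrow> Some 5 | cIndOrd \<Rightarrow> Some 6 | _ \<Rightarrow> None)"

definition contract :: "const \<Rightarrow> tm list \<Rightarrow> const \<Rightarrow> tm list \<Rightarrow> tm option" where
  "contract c as d bs = (case c of
     cIndSigma \<Rightarrow> (case as of [A, B, C, g] \<Rightarrow>
       (case d of cPair \<Rightarrow> (case bs of [A', B', a, b] \<Rightarrow> Some (App
         (App g a) b) | _ \<Rightarrow> None) | _ \<Rightarrow> None) | _ \<Rightarrow> None)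
   | cIndSum \<Rightarrow> (case as of [A, B, C, l, r] \<Rightarrow>
       (case d of cInl \<Rightarrow> (case bs of [A', B', a] \<Rightarrow> Some (App l a) | _ \<Rightarrow> None)
        | cInr \<Rightarrow> (case bs of [A', B', a] \<Rightarrow> Some (App r a) | _ \<Rightarrow> None) | _ \<Rightarrow> None) | _ \<Rightarrow> None)
   | cIndUnit \<Rightarrow> (case as of [C, e] \<Rightarrow>
       (case d of cStar \<Rightarrow> (case bs of [] \<Rightarrow> Some e | _ \<Rightarrow> None) | _ \<Rightarrow> None) | _ \<Rightarrow> None)
   | cIndNat \<Rightarrow> (case as of [C, z, s] \<Rightarrow>
       (case d of cZero \<Rightarrow> (case bs of [] \<Rightarrow> Some z | _ \<Rightarrow> None)
        | cSucc \<Rightarrow> (case bs of [n] \<Rightarrow> Some (App (App s n)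
          (apps cIndNat [C, z, s, n])) | _ \<Rightarrow> None) | _ \<Rightarrow> None) | _ \<Rightarrow> None)
   | cIndId \<Rightarrow> (case as of [A, C, e, x, y] \<Rightarrow>
       (case d of cRefl \<Rightarrow> (case bs of [A', a] \<Rightarrow> Some (App e a) | _ \<Rightarrow> None) | _ \<Rightarrow> None) | _ \<Rightarrow> None)
   | cIndOrd \<Rightarrow> (case as of [C, z, sl, sr, k, l] \<Rightarrow>
       (case d of cOZero \<Rightarrow> (case bs of [] \<Rightarrow> Some z | _ \<Rightarrow> None)
        | cOSl \<Rightarrow> (case bs of [m, n, f] \<Rightarrow> Some (App (App (App (App sl m) n) f)
          (apps cIndOrd [C, z, sl, sr, m, apps cSucc [n], f])) | _ \<Rightarrow> None)
        | cOSr \<Rightarrow> (case bs of [m, n, f] \<Rightarrow> Some (App (App (App (App sr m) n) f)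
          (apps cIndOrd [C, z, sl, sr, m, n, f])) | _ \<Rightarrow> None)
        | _ \<Rightarrow> None) | _ \<Rightarrow> None)
   | _ \<Rightarrow> None)"

text \<open>
  \<open>whnf n t as\<close> reduces the spine \<open>foldl App t as\<close>. Like all functions below it takes fuel \<open>n\<close>;
  running out of fuel costs completeness only.
\<close>

definition whnf_step :: "(tm \<Rightarrow> tm list \<Rightarrow> tm) \<Rightarrow> tm \<Rightarrow> tm list \<Rightarrow> tm" where
  "whnf_step w t as = (case t of
     App f a \<Rightarrow> w f (a # as)
   | Lam b \<Rightarrow> (case as of [] \<Rightarrow> t | a # as' \<Rightarrow> w (inst 0 a b) as')
   | Const c \<Rightarrow> (case scrutinee c of None \<Rightarrow> foldl App t as | Some k \<Rightarrow>
       (case drop k as of [] \<Rightarrow> foldl App t as | a # as' \<Rightarrow>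
         (case strip (w a []) [] of None \<Rightarrow> foldl App t as | Some (d, bs) \<Rightarrow>
           (case contract c (take k as) d bs of None \<Rightarrow> foldl App t as | Some u \<Rightarrow> w u as'))))
   | _ \<Rightarrow> foldl App t as)"

primrec whnf :: "nat \<Rightarrow> tm \<Rightarrow> tm list \<Rightarrow> tm" where
  "whnf 0 t as = foldl App t as"
| "whnf (Suc n) t as = whnf_step (whnf n) t as"

text \<open>The argument \<open>e\<close> is the recursive test on subterms. An abstraction facing
  any other term is compared with the eta-expansion of that term.\<close>

fun eqv_whnf :: "(tm \<Rightarrow> tm \<Rightarrow> bool) \<Rightarrow> tm \<Rightarrow> tm \<Rightarrow> bool" where
  "eqv_whnf e (Lam b) (Lam c) = e b c"
| "eqv_whnf e (Lam b) u = e b (App (lift 0 u) (Var 0))"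
| "eqv_whnf e t (Lam c) = e (App (lift 0 t) (Var 0)) c"
| "eqv_whnf e (Pi A B) (Pi A' B') = (if e A A' then e B B' else False)"
| "eqv_whnf e (App f a) (App g b) = (if e f g then e a b else False)"
| "eqv_whnf e t u = (t = u)"

primrec eqv :: "nat \<Rightarrow> tm \<Rightarrow> tm \<Rightarrow> bool" where
  "eqv 0 t u = False"
| "eqv (Suc n) t u = (if same t u then True else eqv_whnf (eqv n) (whnf n t []) (whnf n u []))"

type_synonym env = "const \<Rightarrow> nat option"

text \<open>Cumulativity is tried only when the whole type reduces to a universe; other types are
  compared up to conversion, never covariantly under a \<open>Pi\<close>.\<close>

definition subsumed :: "nat \<Rightarrow> tm \<Rightarrow> tm \<Rightarrow> bool" where
  "subsumed n S T = (if same S T then True else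
     (case whnf n S [] of U i \<Rightarrow> (case whnf n T [] of U j \<Rightarrow> i \<le> j | _ \<Rightarrow> False) | S' \<Rightarrow> eqv n S' T))"

definition as_univ :: "nat \<Rightarrow> tm option \<Rightarrow> nat option" where
  "as_univ n x = (case x of None \<Rightarrow> None | Some T \<Rightarrow> (case whnf n T [] of U i \<Rightarrow> Some i | _ \<Rightarrow> None))"

type_synonym inference = "tm list \<Rightarrow> tm \<Rightarrow> tm list \<Rightarrow> tm option"

text \<open>
  When a type has to be reduced to become a \<open>\<Pi>\<close>-type, the reduct is type-checked again. This makes
  confluence and subject reduction unnecessary for soundness.
\<close>

definition as_pi :: "inference \<Rightarrow> nat \<Rightarrow> tm list \<Rightarrow> tm \<Rightarrow> (tm \<times> tm) option" where
  "as_pi rec n \<Gamma> T = (case T of Pi A B \<Rightarrow> Some (A, B)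
   | _ \<Rightarrow> (case whnf n T [] of Pi A B \<Rightarrow>
       (case as_univ n (rec \<Gamma> (Pi A B) []) of None \<Rightarrow> None | Some i \<Rightarrow> Some (A, B)) | _ \<Rightarrow> None))"

definition check_infer :: "inference \<Rightarrow> nat \<Rightarrow> tm list \<Rightarrow> tm \<Rightarrow> tm \<Rightarrow> bool" where
  "check_infer rec n \<Gamma> t T = (case rec \<Gamma> t [] of None \<Rightarrow> False | Some S \<Rightarrow> subsumed n S T)"

text \<open>Abstractions carry no domain, so they are checked against a \<open>Pi\<close>-type; for
  every other term a type is inferred and compared.\<close>

fun check :: "inference \<Rightarrow> nat \<Rightarrow> tm list \<Rightarrow> tm \<Rightarrow> tm \<Rightarrow> bool" where
  "check rec n \<Gamma> (Lam b) T = (case as_pi rec n \<Gamma> T of None \<Rightarrow> False | Some (A, B) \<Rightarrow> check rec n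
    (A # \<Gamma>) b B)"
| "check rec n \<Gamma> t T = check_infer rec n \<Gamma> t T"

text \<open>Singles out redexes, where inference starts with the arguments since an unannotated
  abstraction does not reveal its domain.\<close>

fun lam_headed :: "tm \<Rightarrow> bool" where
  "lam_headed (App f a) = lam_headed f"
| "lam_headed (Lam b) = True"
| "lam_headed _ = False"

text \<open>
  \<open>infer_step E D rec n \<Gamma> t As\<close>: \<open>E\<close> assigns universe levels to constants, \<open>D\<close> assigns types to
  closed \<open>\<lambda>\<close>-abstractions, and \<open>As\<close> are the types of the arguments that \<open>t\<close> is applied to, which
  allow to infer the types of other \<open>\<lambda>\<close>-abstractions in head position.
\<close>

definition infer_step :: "env \<Rightarrow> (tm \<Rightarrow> tm option) \<Rightarrow> inference \<Rightarrow> nat \<Rightarrow> inference" where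
  "infer_step E D rec n \<Gamma> t As = (case t of
     Var k \<Rightarrow> if k < length \<Gamma> then Some (shift (Suc k) 0 (\<Gamma> ! k)) else None
   | U i \<Rightarrow> Some (U (Suc i))
   | Pi A B \<Rightarrow> (case as_univ n (rec \<Gamma> A []) of None \<Rightarrow> None | Some i \<Rightarrow>
       (case as_univ n (rec (A # \<Gamma>) B []) of None \<Rightarrow> None | Some j \<Rightarrow> Some (U (max i j))))
   | Const c \<Rightarrow> (case E c of None \<Rightarrow> None | Some i \<Rightarrow> Some (const_type c i 0))
   | Lam b \<Rightarrow> (case D t of Some T \<Rightarrow> Some T | None \<Rightarrow> (case As of [] \<Rightarrow> None | A # As' \<Rightarrow>
       (case rec (A # \<Gamma>) b (map (lift 0) As') of None \<Rightarrow> None | Some B \<Rightarrow> Some (Pi A B))))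
   | App f a \<Rightarrow>
     (if lam_headed f then
       (case rec \<Gamma> a [] of None \<Rightarrow> None | Some A \<Rightarrow>
         (case rec \<Gamma> f (A # As) of None \<Rightarrow> None | Some T \<Rightarrow>
           (case as_pi rec n \<Gamma> T of None \<Rightarrow> None | Some (A', B) \<Rightarrow>
             if subsumed n A A' then Some (inst 0 a B) else None)))
     else (case rec \<Gamma> f [] of None \<Rightarrow> None | Some T \<Rightarrow>
         (case as_pi rec n \<Gamma> T of None \<Rightarrow> None | Some (A, B) \<Rightarrow>
           if check rec n \<Gamma> a A then Some (inst 0 a B) else None))))"

primrec infer :: "env \<Rightarrow> (tm \<Rightarrow> tm option) \<Rightarrow> nat \<Rightarrow> inference" where
  "infer E D 0 \<Gamma> t As = None"
| "infer E D (Suc n) \<Gamma> t As = infer_step E D (infer E D n) n \<Gamma> t As"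

definition fuel :: nat where "fuel = 500"

definition env_upto :: "const list \<Rightarrow> env" where
  "env_upto cs c = (if c \<in> set cs then Some 0 else None)"

text \<open>The most recent constant comes first, and its type is checked with only the constants
  after it available, which excludes circularity. Checking level 0 is enough because derivations can
  be shifted.\<close>

fun valid_sig :: "const list \<Rightarrow> bool" where
  "valid_sig [] = True"
| "valid_sig (c # cs) = (valid_sig cs \<and> as_univ fuel (infer (env_upto cs) (\<lambda>_. None) fuel []
  (const_type c 0 0) []) \<noteq> None)"

text \<open>\<open>check\<close> presupposes that its target is a type, so \<open>T\<close> itself
  is examined first.\<close>

definition check_def :: "env \<Rightarrow> (tm \<Rightarrow> tm option) \<Rightarrow> tm list \<Rightarrow> tm \<Rightarrow> tm \<Rightarrow> bool" where
  "check_def E D \<Gamma> t T = (if as_univ fuel (infer E D fuel \<Gamma> T []) = None then False else check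
    (infer E D fuel) fuel \<Gamma> t T)"

section \<open>Substitution and universe shifts\<close>

lemma lift_subst: "j \<le> k \<Longrightarrow> lift k (subst j u t) = subst j (lift k u) (lift (Suc k) t)"
  by (induction t arbitrary: j k u) (auto simp: lift_lift[of 0, simplified])

lemma subst_subst:
  "i \<le> k \<Longrightarrow> subst k u (subst i v t) = subst i (subst k u v) (subst (Suc k) (lift i u) t)"
proof (induction t arbitrary: i k u v)
  case (Var n)
  consider "n < i" | "n = i" | "n > i" by linarith
  then show ?case using Var
    by cases (auto simp: subst_lift)
qed (auto simp: lift_lift[of 0, simplified] subst_lift_le[of 0, simplified])

lemma compute_lift: "compute t u \<Longrightarrow> compute (lift k t) (lift k u)"
  by (induction rule: compute.induct) (auto intro: compute.intros[simplified])

lemma compute_subst: "compute t u \<Longrightarrow> compute (subst k v t) (subst k v u)"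
  by (induction rule: compute.induct) (auto intro: compute.intros[simplified])

lemma conv_lift: "t \<approx> u \<Longrightarrow> lift k t \<approx> lift k u"
proof (induction arbitrary: k rule: conv.induct)
  case (conv_beta b a)
  then show ?case using conv.conv_beta[of "lift (Suc k) b" "lift k a"] by (simp add: lift_subst)
next
  case (conv_eta f)
  then show ?case using conv.conv_eta[of "lift k f"] by (simp add: lift_lift[of 0, simplified])
next
  case conv_trans
  then show ?case by (blast intro: conv.conv_trans)
qed (auto intro: conv.intros compute_lift)

lemma conv_subst: "t \<approx> u \<Longrightarrow> subst k v t \<approx> subst k v u"
proof (induction arbitrary: k v rule: conv.induct)
  case (conv_beta b a)
  then show ?case using conv.conv_beta[of "subst (Suc k) (lift 0 v) b" "subst k v a"]
    by (simp add: subst_subst)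
next
  case (conv_eta f)
  then show ?case using conv.conv_eta[of "subst k v f"] by (simp add: subst_lift_le[of 0, simplified])
next
  case conv_trans
  then show ?case by (blast intro: conv.conv_trans)
qed (auto intro: conv.intros compute_subst)

text \<open>Rewriting with this collection expands named-variable builders into raw de Bruijn terms,
  the form that the checker evaluates.\<close>

named_theorems term_defs

lemmas [term_defs] = Let_def truncated.simps One_nat_def length_Cons list.size(3) pi_def lam_def app_def
  univ_def cst_def bound_var_def arrow_def sigma_def times_def pair_def split_pair_def first_def path_def
  refl_at_def is_equiv_def equiv_type_def id_equiv_def happly_def id_to_equiv_def fibre_def
  truncated_map_def ident'_type_def cmp'_type_def conf_type_def homp_type_def from_conf_def from_homp_def
  from_hom_def from_objp_def concrete_cat_def ident_type_def cmp_type_def cat_data_def mk_cat_data_def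
  ident_of_def cmp_of_def underlying_def ord_id_def nat_pred_def ord_comp_Sl_def ord_comp_rec_def
  ord_comp_def simplex_data_def

lemma lift_const_type [simp]: "lift k (const_type c i 0) = const_type c i 0"
  by (cases c) (simp_all add: term_defs)

lemma subst_const_type [simp]: "subst k u (const_type c i 0) = const_type c i 0"
  by (cases c) (simp_all add: term_defs)

section \<open>Raising all universe levels\<close>

primrec up :: "nat \<Rightarrow> tm \<Rightarrow> tm" where
  "up l (Var n) = Var n"
| "up l (U i) = U (i + l)"
| "up l (Pi A B) = Pi (up l A) (up l B)"
| "up l (Lam b) = Lam (up l b)"
| "up l (App f a) = App (up l f) (up l a)"
| "up l (Const c) = Const c"

lemma up_lift: "up l (lift k t) = lift k (up l t)"
  by (induction t arbitrary: k) auto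

lemma up_lift_funpow: "up l ((lift k ^^ n) t) = (lift k ^^ n) (up l t)"
  by (induction n) (auto simp: up_lift)

lemma up_subst: "up l (subst k u t) = subst k (up l u) (up l t)"
  by (induction t arbitrary: k u) (auto simp: up_lift)

lemma compute_up: "compute t u \<Longrightarrow> compute (up l t) (up l u)"
  by (induction rule: compute.induct) (auto intro: compute.intros[simplified])

lemma conv_up: "t \<approx> u \<Longrightarrow> up l t \<approx> up l u"
proof (induction rule: conv.induct)
  case (conv_beta b a)
  then show ?case using conv.conv_beta[of "up l b" "up l a"] by (simp add: up_subst)
next
  case (conv_eta f)
  then show ?case using conv.conv_eta[of "up l f"] by (simp add: up_lift)
next
  case conv_trans
  then show ?case by (blast intro: conv.conv_trans)
qed (auto intro: conv.intros compute_up)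

lemma up_const_type: "up l (const_type c i 0) = const_type c (i + l) 0"
  by (cases c) (simp_all add: term_defs)

text \<open>Every rule is uniform in the levels, and constants do not record theirs, so adding
  \<open>l\<close> everywhere maps derivations to derivations.\<close>

lemma typing_up:
  "ctx \<Gamma> \<Longrightarrow> ctx (map (up l) \<Gamma>)"
  "has_type \<Gamma> t T \<Longrightarrow> has_type (map (up l) \<Gamma>) (up l t) (up l T)"
proof (induction rule: ctx_has_type.inducts)
  case (type_Var \<Gamma> n)
  then show ?case using ctx_has_type.type_Var[of "map (up l) \<Gamma>" n]
    by (simp del: funpow.simps add: up_lift_funpow)
next
  case (type_Const \<Gamma> c i)
  then show ?case using ctx_has_type.type_Const[of "map (up l) \<Gamma>" c "i + l"] by (simp add: up_const_type)
next
  case (type_App \<Gamma> f A B a)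
  then show ?case using ctx_has_type.type_App by (simp add: up_subst)
next
  case (type_conv \<Gamma> t A B i)
  then show ?case by (auto intro: ctx_has_type.type_conv conv_up)
qed (auto intro: ctx_has_type.intros)

lemma ctx_of_typing: "ctx \<Gamma> \<Longrightarrow> ctx \<Gamma>" "has_type \<Gamma> t T \<Longrightarrow> ctx \<Gamma>"
  by (induction rule: ctx_has_type.inducts) (auto elim: ctx.cases intro: ctx_has_type.intros)

section \<open>Weakening\<close>

primrec lift_ctx :: "tm list \<Rightarrow> tm list" where
  "lift_ctx [] = []"
| "lift_ctx (A # \<Delta>) = lift (length \<Delta>) A # lift_ctx \<Delta>"

lemma length_lift_ctx [simp]: "length (lift_ctx \<Delta>) = length \<Delta>"
  by (induction \<Delta>) auto

lemma nth_lift_ctx: "n < length \<Delta> \<Longrightarrow> lift_ctx \<Delta> ! n = lift (length \<Delta> - Suc n) (\<Delta> ! n)"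
  by (induction \<Delta> arbitrary: n) (auto simp: nth_Cons split: nat.splits)

lemma lift_funpow_add: "lift (k + n) ((lift 0 ^^ n) t) = (lift 0 ^^ n) (lift k t)"
  by (induction n) (simp_all flip: lift_lift[of 0, simplified])

lemma lift_funpow_le: "k \<le> n \<Longrightarrow> lift k ((lift 0 ^^ n) t) = (lift 0 ^^ Suc n) t"
proof (induction n arbitrary: k)
  case (Suc n)
  show ?case
  proof (cases k)
    case (Suc j)
    then show ?thesis using Suc.IH[of j] Suc.prems lift_lift[of 0 j "(lift 0 ^^ n) t"] by simp
  qed simp
qed simp

text \<open>The rules for \<open>Pi\<close> and \<open>Lam\<close> extend the context, so the new
  variable is inserted below an arbitrary prefix, whose entries \<open>lift_ctx\<close>
  adjusts.\<close>

lemma weakening_gen: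
  "ctx \<Gamma>' \<Longrightarrow> (\<And>\<Delta>. \<Gamma>' = \<Delta> @ \<Gamma> \<Longrightarrow> has_type \<Gamma> A (U i) \<Longrightarrow> ctx (lift_ctx \<Delta> @ A # \<Gamma>))"
  "has_type \<Gamma>' t T \<Longrightarrow> (\<And>\<Delta>. \<Gamma>' = \<Delta> @ \<Gamma> \<Longrightarrow> has_type \<Gamma> A (U i) \<Longrightarrow>
     has_type (lift_ctx \<Delta> @ A # \<Gamma>) (lift (length \<Delta>) t) (lift (length \<Delta>) T))"
proof (induction rule: ctx_has_type.inducts)
  case ctx_Nil
  then show ?case by (auto intro: ctx_has_type.ctx_Nil ctx_has_type.ctx_Cons)
next
  case (ctx_Cons \<Gamma>'' B j)
  show ?case
  proof (cases \<Delta>)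
    case Nil
    then show ?thesis using ctx_Cons ctx_has_type.ctx_Cons by auto
  next
    case (Cons B' \<Delta>')
    then have "has_type (lift_ctx \<Delta>' @ A # \<Gamma>) (lift (length \<Delta>') B) (U j)" "ctx (lift_ctx \<Delta>' @ A # \<Gamma>)"
      using ctx_Cons.IH ctx_Cons.prems by auto
    then show ?thesis using Cons ctx_Cons.prems ctx_has_type.ctx_Cons by auto
  qed
next
  case (type_Var \<Gamma>'' n)
  have c: "ctx (lift_ctx \<Delta> @ A # \<Gamma>)" using type_Var by blast
  show ?case
  proof (cases "n < length \<Delta>")
    case True
    then have k: "length \<Delta> - Suc n + Suc n = length \<Delta>" by simp
    have "lift (length \<Delta>) ((lift 0 ^^ Suc n) (\<Gamma>'' ! n)) = (lift 0 ^^ Suc n) ((lift_ctx \<Delta> @ A # \<Gamma>) ! n)"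
      using lift_funpow_add[of "length \<Delta> - Suc n" "Suc n" "\<Delta> ! n", unfolded k] type_Var.prems True
      by (simp del: funpow.simps add: nth_append nth_lift_ctx)
    then show ?thesis using ctx_has_type.type_Var[OF c, of n] True by (simp del: funpow.simps)
  next
    case False
    then have "lift (length \<Delta>) ((lift 0 ^^ Suc n) (\<Gamma>'' ! n)) = (lift 0 ^^ Suc (Suc n))
      ((lift_ctx \<Delta> @ A # \<Gamma>) ! Suc n)"
      using type_Var.prems by (simp del: funpow.simps add: lift_funpow_le nth_append Suc_diff_le)
    then show ?thesis using ctx_has_type.type_Var[OF c, of "Suc n"] False type_Var
      by (simp del: funpow.simps)
  qed
next
  case (type_Pi \<Gamma>'' B j C)
  show ?case using type_Pi.IH(1)[OF type_Pi.prems] type_Pi.IH(2)[of "B # \<Delta>"] type_Pi.prems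
    by (auto intro: ctx_has_type.type_Pi)
next
  case (type_Lam B \<Gamma>'' b C)
  show ?case using type_Lam.IH[of "B # \<Delta>"] type_Lam.prems by (auto intro: ctx_has_type.type_Lam)
next
  case (type_App \<Gamma>'' f B C a)
  show ?case using ctx_has_type.type_App[OF type_App.IH(1)[OF type_App.prems, simplified]
    type_App.IH(2)[OF type_App.prems]]
    by (simp add: lift_subst)
next
  case (type_Const \<Gamma>'' c j)
  then show ?case by (auto intro: ctx_has_type.type_Const)
next
  case (type_conv \<Gamma>'' t B C j)
  then show ?case by (auto intro: ctx_has_type.type_conv conv_lift)
qed (auto intro: ctx_has_type.ctx_Nil ctx_has_type.type_U ctx_has_type.type_cumulative)

lemma weakening: "has_type \<Gamma> t T \<Longrightarrow> has_type \<Gamma> A (U i) \<Longrightarrow> has_type (A # \<Gamma>) (lift 0 t) (lift 0 T)"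
  using weakening_gen(2)[where \<Gamma>=\<Gamma> and \<Delta>="[]"] by simp

lemma weakening_append: "ctx (\<Delta> @ \<Gamma>) \<Longrightarrow> has_type \<Gamma> t T \<Longrightarrow>
   has_type (\<Delta> @ \<Gamma>) ((lift 0 ^^ length \<Delta>) t) ((lift 0 ^^ length \<Delta>) T)"
proof (induction \<Delta>)
  case (Cons A \<Delta>)
  from Cons.prems(1) obtain i where "ctx (\<Delta> @ \<Gamma>)" "has_type (\<Delta> @ \<Gamma>) A (U i)" by (auto elim: ctx.cases)
  then show ?case using Cons weakening by simp
qed simp

section \<open>Substitution of typed terms\<close>

primrec subst_ctx :: "tm \<Rightarrow> tm list \<Rightarrow> tm list" where
  "subst_ctx u [] = []"
| "subst_ctx u (A # \<Delta>) = subst (length \<Delta>) ((lift 0 ^^ length \<Delta>) u) A # subst_ctx u \<Delta>"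

lemma length_subst_ctx [simp]: "length (subst_ctx u \<Delta>) = length \<Delta>"
  by (induction \<Delta>) auto

lemma nth_subst_ctx: "n < length \<Delta> \<Longrightarrow>
   subst_ctx u \<Delta> ! n = subst (length \<Delta> - Suc n) ((lift 0 ^^ (length \<Delta> - Suc n)) u) (\<Delta> ! n)"
  by (induction \<Delta> arbitrary: n) (auto simp: nth_Cons split: nat.splits)

lemma subst_funpow_add: "subst (k + n) ((lift 0 ^^ (k + n)) u) ((lift 0 ^^ n) t) = (lift 0 ^^ n)
  (subst k ((lift 0 ^^ k) u) t)"
  by (induction n) (simp_all add: subst_lift_le[of 0, simplified])

lemma subst_funpow_le: "k \<le> n \<Longrightarrow> subst k u ((lift 0 ^^ Suc n) t) = (lift 0 ^^ n) t"
  using lift_funpow_le[of k n t] subst_lift[of k u "(lift 0 ^^ n) t"] by simp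

text \<open>As for weakening, the substituted variable sits below an arbitrary prefix. A variable
  lies in the prefix, is the substituted one, or lies beyond it.\<close>

lemma substitution_gen:
  "ctx \<Gamma>' \<Longrightarrow> (\<And>\<Delta>. \<Gamma>' = \<Delta> @ A # \<Gamma> \<Longrightarrow> has_type \<Gamma> u A \<Longrightarrow> ctx (subst_ctx u \<Delta> @ \<Gamma>))"
  "has_type \<Gamma>' t T \<Longrightarrow> (\<And>\<Delta>. \<Gamma>' = \<Delta> @ A # \<Gamma> \<Longrightarrow> has_type \<Gamma> u A \<Longrightarrow>
     has_type (subst_ctx u \<Delta> @ \<Gamma>) (subst (length \<Delta>) ((lift 0 ^^ length \<Delta>) u) t)
       (subst (length \<Delta>) ((lift 0 ^^ length \<Delta>) u) T))"
proof (induction rule: ctx_has_type.inducts)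
  case (ctx_Cons \<Gamma>'' B j)
  show ?case
  proof (cases \<Delta>)
    case Nil
    then show ?thesis using ctx_Cons by auto
  next
    case (Cons B' \<Delta>')
    then show ?thesis using ctx_Cons.IH[of \<Delta>'] ctx_Cons.prems Cons by (auto intro: ctx_has_type.ctx_Cons)
  qed
next
  case (type_Var \<Gamma>'' n)
  have c: "ctx (subst_ctx u \<Delta> @ \<Gamma>)" using type_Var by blast
  consider "n < length \<Delta>" | "n = length \<Delta>" | m where "n = Suc m" "length \<Delta> \<le> m"
    by (metis Suc_le_D linorder_neqE_nat Suc_leI Suc_le_mono)
  then show ?case
  proof cases
    case 1
    then have k: "length \<Delta> - Suc n + Suc n = length \<Delta>" by simp
    have "subst (length \<Delta>) ((lift 0 ^^ length \<Delta>) u) ((lift 0 ^^ Suc n) (\<Gamma>'' ! n))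
      = (lift 0 ^^ Suc n) ((subst_ctx u \<Delta> @ \<Gamma>) ! n)"
      using subst_funpow_add[of "length \<Delta> - Suc n" "Suc n" u "\<Delta> ! n", unfolded k] type_Var.prems 1
      by (simp del: funpow.simps add: nth_append nth_subst_ctx)
    then show ?thesis using ctx_has_type.type_Var[OF c, of n] 1 by (simp del: funpow.simps)
  next
    case 2
    \<comment> \<open>The variable turns into \<open>u\<close>, whose typing is weakened along the
      substituted prefix.\<close>
    then show ?thesis using weakening_append[OF c type_Var.prems(2)] type_Var.prems
      by (simp del: funpow.simps add: subst_funpow_le)
  next
    case 3
    then show ?thesis using ctx_has_type.type_Var[OF c, of m] type_Var
      by (simp del: funpow.simps add: subst_funpow_le nth_append Suc_diff_le)
  qed
next
  case (type_Pi \<Gamma>'' B j C)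
  show ?case using type_Pi.IH(1)[OF type_Pi.prems] type_Pi.IH(2)[of "B # \<Delta>"] type_Pi.prems
    by (auto intro: ctx_has_type.type_Pi)
next
  case (type_Lam B \<Gamma>'' b C)
  show ?case using type_Lam.IH[of "B # \<Delta>"] type_Lam.prems by (auto intro: ctx_has_type.type_Lam)
next
  case (type_App \<Gamma>'' f B C a)
  show ?case using ctx_has_type.type_App[OF type_App.IH(1)[OF type_App.prems, simplified]
    type_App.IH(2)[OF type_App.prems]]
    by (simp add: subst_subst)
next
  case (type_Const \<Gamma>'' c j)
  then show ?case by (auto intro: ctx_has_type.type_Const)
next
  case (type_conv \<Gamma>'' t B C j)
  then show ?case by (auto intro: ctx_has_type.type_conv conv_subst)
qed (auto intro: ctx_has_type.ctx_Nil ctx_has_type.type_U ctx_has_type.type_cumulative)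

lemma substitution: "has_type (A # \<Gamma>) t T \<Longrightarrow> has_type \<Gamma> u A \<Longrightarrow> has_type \<Gamma> (subst 0 u t) (subst 0 u T)"
  using substitution_gen(2)[where \<Gamma>=\<Gamma> and \<Delta>="[]"] by simp

text \<open>Rule \<open>type_Var\<close> bounds every free index by the length of the context. In
  particular closed typed terms are fixed by lifting.\<close>

lemma lift_typed: "ctx \<Gamma> \<Longrightarrow> True" "has_type \<Gamma> t T \<Longrightarrow> length \<Gamma> \<le> k \<Longrightarrow> lift k t = t"
  by (induction arbitrary: k and k rule: ctx_has_type.inducts) auto

text \<open>Besides \<open>type_Pi\<close>, only cumulativity and conversion can end a typing of a
  \<open>Pi\<close>, and both leave the term unchanged.\<close>

lemma Pi_typed_inversion:
  "ctx \<Gamma> \<Longrightarrow> True"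
  "has_type \<Gamma> t T \<Longrightarrow> t = Pi A B \<Longrightarrow> \<exists>i. has_type \<Gamma> A (U i) \<and> has_type (A # \<Gamma>) B (U i)"
  by (induction rule: ctx_has_type.inducts) auto

definition is_type :: "tm list \<Rightarrow> tm \<Rightarrow> bool" where
  "is_type \<Gamma> T \<longleftrightarrow> (\<exists>i. has_type \<Gamma> T (U i))"

lemma closed_weakening:
  assumes "has_type [] t T" "is_type [] T" "ctx \<Gamma>"
  shows "has_type \<Gamma> t T \<and> is_type \<Gamma> T"
proof -
  obtain i where i: "has_type [] T (U i)" using assms by (auto simp: is_type_def)
  have f: "(lift 0 ^^ n) t = t" "(lift 0 ^^ n) T = T" "(lift 0 ^^ n) (U i) = U i" for n
    using lift_typed(2)[OF assms(1), of 0] lift_typed(2)[OF i, of 0] by (induction n) auto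
  show ?thesis using weakening_append[of \<Gamma> "[]", OF _ assms(1)] weakening_append[of \<Gamma>
    "[]", OF _ i] assms(3) f
    by (auto simp: is_type_def)
qed

lemma cumulative: "has_type \<Gamma> A (U i) \<Longrightarrow> i \<le> j \<Longrightarrow> has_type \<Gamma> A (U j)"
  by (induction j) (auto simp: le_Suc_eq intro: type_cumulative)

lemma type_conv_U: "has_type \<Gamma> A T \<Longrightarrow> T \<approx> U i \<Longrightarrow> has_type \<Gamma> A (U i)"
  by (meson ctx_of_typing(2) type_U type_conv)

lemma is_type_Pi: "is_type \<Gamma> (Pi A B) \<longleftrightarrow> is_type \<Gamma> A \<and> is_type (A # \<Gamma>) B"
proof
  assume "is_type \<Gamma> (Pi A B)"
  then show "is_type \<Gamma> A \<and> is_type (A # \<Gamma>) B"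
    unfolding is_type_def using Pi_typed_inversion(2) by blast
next
  assume "is_type \<Gamma> A \<and> is_type (A # \<Gamma>) B"
  then obtain i j where "has_type \<Gamma> A (U i)" "has_type (A # \<Gamma>) B (U j)" by (auto simp: is_type_def)
  then show "is_type \<Gamma> (Pi A B)" unfolding is_type_def
    using type_Pi[OF cumulative[of _ _ i "max i j"] cumulative[of _ _ j "max i j"]] by fastforce
qed

section \<open>Soundness of the checker\<close>

lemma strip_sound: "strip t as = Some (d, bs) \<Longrightarrow> foldl App t as = foldl App (Const d) bs"
  by (induction t as rule: strip.induct) auto

lemma contract_sound:
  "contract c as d bs = Some u \<Longrightarrow> compute (foldl App (Const c) (as @ [foldl App (Const d) bs])) u"
  by (auto simp: contract_def split: const.splits list.splits intro: compute.intros[simplified])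

lemma whnf_sound: "foldl App t as \<approx> whnf n t as"
proof (induction n arbitrary: t as)
  case 0
  show ?case by (simp add: conv_refl)
next
  case (Suc n)
  show ?case
  proof (cases t)
    case (Lam b)
    show ?thesis
    proof (cases as)
      case (Cons a as')
      then show ?thesis using beta_step[where a = a and b = b, OF Suc] Lam
        by (simp add: whnf_step_def inst_0)
    qed (use Lam in \<open>simp add: whnf_step_def inst_0 conv_refl\<close>)
  next
    case (App f a)
    then show ?thesis using Suc[of f "a # as"] by (simp add: whnf_step_def inst_0)
  next
    case (Const c)
    have "foldl App (Const c) as \<approx> whnf n u as'"
      if "drop k as = a # as'" "strip (whnf n a []) [] = Some (d, bs)" "contract c
        (take k as) d bs = Some u" for k a as' d bs u
    proof -
      have as: "as = take k as @ a # as'" using that(1) by (metis append_take_drop_id)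
      \<comment> \<open>The scrutinee is reduced first; as conversion is a congruence, the
        computation rule for its reduct applies.\<close>
      have "a \<approx> foldl App (Const d) bs" using Suc[of a "[]"] strip_sound[OF that(2)] by simp
      then have "foldl App (Const c) (take k as @ [a]) \<approx> u"
        using conv_compute[OF contract_sound[OF that(3)]] by (auto intro: conv_trans conv_App conv_refl)
      from conv_apps[OF this, of as'] have "foldl App (Const c) as \<approx> foldl App u as'" by (subst as) simp
      then show ?thesis using Suc by (rule conv_trans)
    qed
    then show ?thesis using Const
      by (auto simp: whnf_step_def inst_0 conv_refl split: option.splits list.splits)
  qed (simp_all add: whnf_step_def inst_0 conv_refl)
qed

lemma whnf_sound': "t \<approx> whnf n t []"
  using whnf_sound[of t "[]"] by simp

lemma conv_eta_expand: "b \<approx> App (lift 0 u) (Var 0) \<Longrightarrow> Lam b \<approx> u"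
  by (rule conv_trans[OF conv_Lam conv_eta])

lemma eqv_whnf_sound:
  assumes "\<And>t u. e t u \<Longrightarrow> t \<approx> u" "eqv_whnf e t u"
  shows "t \<approx> u"
  using assms(2)
  by (cases "(e, t, u)" rule: eqv_whnf.cases)
    (auto simp del: lift.simps split: if_splits dest!: assms(1)
      intro: conv_refl conv_Lam conv_Pi conv_App conv_eta_expand conv_sym[OF conv_eta_expand[OF
        conv_sym]])

lemma eqv_sound: "eqv n t u \<Longrightarrow> t \<approx> u"
proof (induction n arbitrary: t u)
  case (Suc n)
  show ?case
  proof (cases "t = u")
    case False
    then have "whnf n t [] \<approx> whnf n u []" using Suc eqv_whnf_sound[of "eqv n"] by (simp add: same_iff)
    then show ?thesis by (meson conv_sym conv_trans whnf_sound')
  qed (simp add: conv_refl)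
qed simp

lemma subsumed_sound:
  assumes "subsumed n S T" "has_type \<Gamma> t S" "is_type \<Gamma> T"
  shows "has_type \<Gamma> t T"
proof -
  obtain k where k: "has_type \<Gamma> T (U k)" using assms(3) by (auto simp: is_type_def)
  have eqv: "has_type \<Gamma> t T" if "eqv n (whnf n S []) T"
    using type_conv[OF assms(2) conv_trans[OF whnf_sound' eqv_sound[OF that]] k] .
  show ?thesis
  proof (cases "\<exists>i j. whnf n S [] = U i \<and> whnf n T [] = U j \<and> i \<le> j")
    case True
    \<comment> \<open>Both types are universes up to conversion: convert to the smaller one, climb
      by cumulativity, and convert back to \<open>T\<close>.\<close>
    then obtain i j where "S \<approx> U i" "T \<approx> U j" "i \<le> j" using whnf_sound' by metis
    then have "has_type \<Gamma> t (U j)" using type_conv_U[OF assms(2)] cumulative by blast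
    then show ?thesis using type_conv[OF _ conv_sym[OF \<open>T \<approx> U j\<close>] k] by blast
  next
    case False
    then show ?thesis using assms(1,2) eqv by (auto simp: subsumed_def same_iff split: if_splits
      tm.splits)
  qed
qed

lemma as_univ_sound:
  assumes "as_univ n x = Some i"
  obtains T where "x = Some T" "\<And>\<Gamma> A. has_type \<Gamma> A T \<Longrightarrow> has_type \<Gamma> A (U i)"
proof -
  obtain T where "x = Some T" "whnf n T [] = U i"
    using assms by (auto simp: as_univ_def split: option.splits tm.splits)
  then show ?thesis using that type_conv_U whnf_sound' by metis
qed

text \<open>The invariant includes \<open>is_type\<close> of the result because
  \<open>type_conv\<close> needs a typed target. The types \<open>As\<close> are assumed well formed
  since they become context entries.\<close>

definition sound :: "inference \<Rightarrow> bool" where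
  "sound rec \<longleftrightarrow> (\<forall>\<Gamma> t As T. ctx \<Gamma> \<longrightarrow> (\<forall>A\<in>set As. is_type \<Gamma> A) \<longrightarrow> rec \<Gamma> t As = Some T
    \<longrightarrow> has_type \<Gamma> t T \<and> is_type \<Gamma> T)"

lemma soundD: "sound rec \<Longrightarrow> ctx \<Gamma> \<Longrightarrow> \<forall>A\<in>set As. is_type \<Gamma> A \<Longrightarrow> rec \<Gamma> t As = Some T \<Longrightarrow> has_type \<Gamma> t T \<and>
  is_type \<Gamma> T"
  by (auto simp: sound_def)

lemma as_univ_infer_sound:
  assumes "sound rec" "ctx \<Gamma>" "as_univ n (rec \<Gamma> A []) = Some i"
  shows "has_type \<Gamma> A (U i)"
  using assms(3) by (rule as_univ_sound) (use soundD[OF assms(1,2), of "[]"] in auto)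

lemma as_pi_sound:
  assumes "sound rec" "is_type \<Gamma> T" "as_pi rec n \<Gamma> T = Some (A, B)"
  shows "T \<approx> Pi A B" "is_type \<Gamma> (Pi A B)"
proof -
  have c: "ctx \<Gamma>" using assms(2) ctx_of_typing(2) by (auto simp: is_type_def)
  have *: "T = Pi A B \<or> (whnf n T [] = Pi A B \<and> is_type \<Gamma> (Pi A B))"
    using assms(3) as_univ_infer_sound[OF assms(1) c] by
      (auto simp: as_pi_def is_type_def split: tm.splits option.splits)
  then show "is_type \<Gamma> (Pi A B)" using assms(2) by auto
  show "T \<approx> Pi A B" using * whnf_sound'[of T n] conv_refl by auto
qed

lemma check_infer_sound:
  "sound rec \<Longrightarrow> is_type \<Gamma> T \<Longrightarrow> check_infer rec n \<Gamma> t T \<Longrightarrow> has_type \<Gamma> t T"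
  using soundD[of rec \<Gamma> "[]" t] subsumed_sound ctx_of_typing(2)
  by (fastforce simp: check_infer_def is_type_def split: option.splits)

lemma check_sound:
  "sound rec \<Longrightarrow> is_type \<Gamma> T \<Longrightarrow> check rec n \<Gamma> t T \<Longrightarrow> has_type \<Gamma> t T"
proof (induction rec n \<Gamma> t T rule: check.induct)
  case (1 rec n \<Gamma> b T)
  then obtain A B where AB: "as_pi rec n \<Gamma> T = Some (A, B)" "check rec n (A # \<Gamma>) b B"
    by (auto split: option.splits)
  note pi = as_pi_sound[OF "1.prems"(1,2) AB(1)]
  have "has_type (A # \<Gamma>) b B" using "1.IH"[OF AB(1) refl "1.prems"(1) _ AB(2)] pi(2)
    by (simp add: is_type_Pi)
  then have "has_type \<Gamma> (Lam b) (Pi A B)" by (rule type_Lam)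
  then show ?case using type_conv[OF _ conv_sym[OF pi(1)]] "1.prems"(2) by (auto simp: is_type_def)
qed (auto intro: check_infer_sound)

lemma is_type_ctx: "is_type \<Gamma> A \<Longrightarrow> ctx (A # \<Gamma>)"
  using ctx_Cons ctx_of_typing(2) unfolding is_type_def by blast

lemma is_type_weakening: "is_type \<Gamma> A \<Longrightarrow> is_type \<Gamma> T \<Longrightarrow> is_type (A # \<Gamma>) (lift 0 T)"
  unfolding is_type_def using weakening by fastforce

lemma is_type_subst: "is_type (A # \<Gamma>) B \<Longrightarrow> has_type \<Gamma> a A \<Longrightarrow> is_type \<Gamma> (subst 0 a B)"
  unfolding is_type_def using substitution by fastforce

lemma is_type_nth: "ctx \<Gamma> \<Longrightarrow> k < length \<Gamma> \<Longrightarrow> is_type \<Gamma> ((lift 0 ^^ Suc k) (\<Gamma> ! k))"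
proof (induction \<Gamma> arbitrary: k)
  case (Cons A \<Gamma>)
  from Cons.prems(1) have A: "ctx \<Gamma>" "is_type \<Gamma> A" by (auto simp: is_type_def elim: ctx.cases)
  then show ?case using Cons by (cases k) (auto intro: is_type_weakening)
qed simp

definition well_typed :: "tm \<Rightarrow> tm \<Rightarrow> bool" where
  "well_typed t T \<longleftrightarrow> has_type [] t T \<and> is_type [] T"

definition valid_env :: "env \<Rightarrow> bool" where
  "valid_env E \<longleftrightarrow> (\<forall>c i. E c = Some i \<longrightarrow> is_type [] (const_type c i 0))"

lemma infer_step_sound:
  assumes E: "valid_env E" and D: "\<forall>t T. D t = Some T \<longrightarrow> well_typed t T" and rec: "sound rec"
  shows "sound (infer_step E D rec n)"
  unfolding sound_def
proof (intro allI impI)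
  fix \<Gamma> t As T
  assume \<Gamma>: "ctx \<Gamma>" and As: "\<forall>A\<in>set As. is_type \<Gamma> A" and T: "infer_step E D rec n \<Gamma> t As = Some T"
  note typed = soundD[OF rec \<Gamma>]
  show "has_type \<Gamma> t T \<and> is_type \<Gamma> T"
  proof (cases t)
    case (Var k)
    then show ?thesis using T type_Var[OF \<Gamma>] is_type_nth[OF \<Gamma>]
      by (auto simp: infer_step_def inst_0 shift_eq_lift simp del: funpow.simps split: if_splits)
  next
    case (U i)
    then show ?thesis using T type_U[OF \<Gamma>] by (auto simp: infer_step_def inst_0 shift_eq_lift
      is_type_def)
  next
    case (Const c)
    then obtain i where i: "E c = Some i" "T = const_type c i 0" using T
      by (auto simp: infer_step_def inst_0 shift_eq_lift split: option.splits)
    then have "has_type [] (Const c) T \<and> is_type [] T" using E type_Const[OF ctx_Nil]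
      by (auto simp: valid_env_def)
    then show ?thesis using closed_weakening \<Gamma> Const by blast
  next
    case (Pi A B)
    then obtain i j where ij: "as_univ n (rec \<Gamma> A []) = Some i" "as_univ n (rec
      (A # \<Gamma>) B []) = Some j" "T = U (max i j)"
      using T by (auto simp: infer_step_def inst_0 shift_eq_lift split: option.splits)
    have A: "has_type \<Gamma> A (U i)" using as_univ_infer_sound[OF rec \<Gamma> ij(1)] .
    have B: "has_type (A # \<Gamma>) B (U j)" using as_univ_infer_sound[OF rec ctx_Cons[OF \<Gamma> A] ij(2)] .
    have "has_type \<Gamma> (Pi A B) T" unfolding ij(3) using type_Pi[OF cumulative[OF A] cumulative[OF B]]
      by simp
    then show ?thesis using type_U[OF \<Gamma>] Pi ij(3) by (auto simp: is_type_def)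
  next
    case (Lam b)
    show ?thesis
    proof (cases "D t")
      case (Some T')
      \<comment> \<open>Table entries are closed, hence typed in every context by weakening.\<close>
      then have "well_typed t T" using T D Lam by (auto simp: infer_step_def inst_0 shift_eq_lift)
      then show ?thesis using closed_weakening \<Gamma> by (auto simp: well_typed_def)
    next
      case None
      then obtain A As' B where AB: "As = A # As'" "rec (A # \<Gamma>) b (map (lift 0) As') = Some B"
        "T = Pi A B"
        using T Lam by (auto simp: infer_step_def inst_0 shift_eq_lift split: option.splits list.splits)
      have A: "is_type \<Gamma> A" using As AB by simp
      have "has_type (A # \<Gamma>) b B \<and> is_type (A # \<Gamma>) B"
        using soundD[OF rec is_type_ctx[OF A] _ AB(2)] As AB(1) is_type_weakening[OF A] by auto
      then show ?thesis using A Lam AB(3) type_Lam by (auto simp: is_type_Pi)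
    qed
  next
    case (App f a)
    show ?thesis
    proof (cases "lam_headed f")
      case True
      then obtain A S A' B where *: "rec \<Gamma> a [] = Some A" "rec \<Gamma> f (A # As) = Some S"
        "as_pi rec n \<Gamma> S = Some (A', B)"
        "subsumed n A A'" "T = subst 0 a B"
        using T App by (auto simp: infer_step_def inst_0 shift_eq_lift split: option.splits if_splits)
      have a: "has_type \<Gamma> a A" "is_type \<Gamma> A" using typed[OF _ *(1)] by auto
      have f: "has_type \<Gamma> f S" "is_type \<Gamma> S" using typed[OF _ *(2)] As a(2) by auto
      note pi = as_pi_sound[OF rec f(2) *(3)]
      have "has_type \<Gamma> f (Pi A' B)" using type_conv[OF f(1) pi(1)] pi(2) by (auto simp: is_type_def)
      moreover have "has_type \<Gamma> a A'" using subsumed_sound[OF *(4) a(1)] pi(2) by (simp add: is_type_Pi)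
      ultimately show ?thesis using type_App is_type_subst pi(2) *(5) App by (auto simp: is_type_Pi)
    next
      case False
      then obtain S A B where *: "rec \<Gamma> f [] = Some S" "as_pi rec n \<Gamma> S = Some (A, B)"
        "check rec n \<Gamma> a A" "T = subst 0 a B"
        using T App by (auto simp: infer_step_def inst_0 shift_eq_lift split: option.splits if_splits)
      have f: "has_type \<Gamma> f S" "is_type \<Gamma> S" using typed[OF _ *(1)] by auto
      note pi = as_pi_sound[OF rec f(2) *(2)]
      have "has_type \<Gamma> f (Pi A B)" using type_conv[OF f(1) pi(1)] pi(2) by (auto simp: is_type_def)
      moreover have "has_type \<Gamma> a A" using check_sound[OF rec _ *(3)] pi(2) by (simp add: is_type_Pi)
      ultimately show ?thesis using type_App is_type_subst pi(2) *(4) App by (auto simp: is_type_Pi)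
    qed
  qed
qed

lemma infer_sound:
  assumes "valid_env E" "\<forall>t T. D t = Some T \<longrightarrow> well_typed t T"
  shows "sound (infer E D n)"
proof (induction n)
  case (Suc n)
  have "infer E D (Suc n) = infer_step E D (infer E D n) n" by (intro ext) simp
  then show ?case using infer_step_sound[OF assms Suc] by simp
qed (simp add: sound_def)

lemma valid_sig_sound: "valid_sig cs \<Longrightarrow> c \<in> set cs \<Longrightarrow> is_type [] (const_type c i 0)"
proof (induction cs arbitrary: c i)
  case (Cons d cs)
  show ?case
  proof (cases "c \<in> set cs")
    case False
    have "valid_env (env_upto cs)" using Cons by (auto simp: valid_env_def env_upto_def)
    then have "sound (infer (env_upto cs) (\<lambda>_. None) fuel)" by (simp add: infer_sound)
    moreover obtain j where "as_univ fuel (infer (env_upto cs) (\<lambda>_. None) fuel []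
      (const_type d 0 0) []) = Some j"
      using Cons.prems(1) by auto
    ultimately have "has_type [] (const_type d 0 0) (U j)" using as_univ_infer_sound ctx_Nil by blast
    \<comment> \<open>The checker has validated level 0; shifting by \<open>i\<close> gives the
      other levels.\<close>
    from typing_up(2)[OF this, of i] show ?thesis using Cons.prems(2) False
      by (auto simp: up_const_type is_type_def)
  qed (use Cons in simp)
qed simp

lemma check_def_sound:
  assumes "valid_env E" "\<forall>t T. D t = Some T \<longrightarrow> well_typed t T" "ctx \<Gamma>" "check_def E D \<Gamma> t T"
  shows "has_type \<Gamma> t T \<and> is_type \<Gamma> T"
proof -
  note s = infer_sound[OF assms(1,2), of fuel]
  obtain i where "as_univ fuel (infer E D fuel \<Gamma> T []) = Some i" using assms(4)
    by (auto simp: check_def_def split: if_splits)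
  then have T: "is_type \<Gamma> T" using as_univ_infer_sound[OF s assms(3)] by (auto simp: is_type_def)
  then show ?thesis using check_sound[OF s T] assms(4) by (auto simp: check_def_def split: if_splits)
qed

lemma well_typed_lookup:
  "\<forall>(t, T)\<in>set ps. well_typed t T \<Longrightarrow> lookup ps t = Some T \<Longrightarrow> well_typed t T"
  using lookup_SomeD by fast

lemma well_typed_check_def:
  "valid_env E \<Longrightarrow> \<forall>t T. D t = Some T \<longrightarrow> well_typed t T \<Longrightarrow> check_def E D [] t T \<Longrightarrow> well_typed t T"
  using check_def_sound ctx_Nil unfolding well_typed_def by blast

text \<open>
  The three universe levels: types in the universe \<open>U 0\<close> over which categories are formed, types
  built from \<open>U 0\<close> itself such as \<open>concrete_cat 0\<close>, and motives of eliminators into \<open>U 1\<close>.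
\<close>

definition sig_env :: env where
  "sig_env c = (case c of
      cSum \<Rightarrow> Some 0 | cInl \<Rightarrow> Some 0 | cInr \<Rightarrow> Some 0 | cEmpty \<Rightarrow> Some 0 | cUnit \<Rightarrow> Some 0 | cStar \<Rightarrow> Some 0
    | cNat \<Rightarrow> Some 0 | cZero \<Rightarrow> Some 0 | cSucc \<Rightarrow> Some 0
    | cOrd \<Rightarrow> Some 0 | cOZero \<Rightarrow> Some 0 | cOSl \<Rightarrow> Some 0 | cOSr \<Rightarrow> Some 0
    | cSigma \<Rightarrow> Some 1 | cPair \<Rightarrow> Some 1 | cId \<Rightarrow> Some 1 | cRefl \<Rightarrow> Some 1 | cFunext \<Rightarrow> Some 1
    | cIndSigma \<Rightarrow> Some 2 | cIndSum \<Rightarrow> Some 2 | cIndEmpty \<Rightarrow> Some 2 | cIndUnit \<Rightarrow> Some 2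
    | cIndNat \<Rightarrow> Some 2 | cIndId \<Rightarrow> Some 2 | cIndOrd \<Rightarrow> Some 2 | _ \<Rightarrow> None)"

lemma valid_sig_env: "valid_env sig_env"
proof -
  let ?cs = "[cFunext, cIndOrd, cOSr, cOSl, cOZero, cOrd, cIndId, cRefl, cId, cIndNat, cSucc, cZero,
    cNat,
    cIndUnit, cStar, cUnit, cIndEmpty, cEmpty, cIndSum, cInr, cInl, cSum, cIndSigma, cPair, cSigma]"
  have "valid_sig ?cs" by code_simp
  moreover have "c \<in> set ?cs" if "sig_env c = Some i" for c i
    using that by (cases c) (simp_all add: sig_env_def)
  ultimately show ?thesis unfolding valid_env_def using valid_sig_sound by blast
qed

text \<open>Each entry is built at the depth given by the number of older entries, so
  \<open>bound_var k\<close> denotes the \<open>k\<close>-th oldest one, counted from 0.\<close>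

primrec telescope :: "term_at list \<Rightarrow> tm list" where
  "telescope [] = []"
| "telescope (T # Ts) = T (length Ts) # telescope Ts"

lemmas [term_defs] = telescope.simps

text \<open>
  Lemmas of type theory are kept opaque: the \<open>k\<close>-th lemma is available to the later ones as the
  context variable \<open>bound_var k\<close>, and its proof term is substituted only at the very end.
\<close>

primrec provable :: "term_at list \<Rightarrow> bool" where
  "provable [] = True"
| "provable (T # Ts) = (provable Ts \<and> is_type (telescope Ts) (T (length Ts)) \<and>
     (\<exists>t. has_type (telescope Ts) t (T (length Ts))))"

lemma ctx_telescope: "provable Ts \<Longrightarrow> ctx (telescope Ts)"
  by (induction Ts) (auto intro: ctx_Nil is_type_ctx)

text \<open>The proof terms are substituted one by one, starting with the most recent lemma; the
  closed type \<open>T\<close> stays the same throughout.\<close>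

lemma provable_cut:
  assumes "provable Ts" "has_type (telescope Ts) t T" "lift 0 T = T"
  shows "\<exists>t. has_type [] t T"
  using assms(1,2)
proof (induction Ts arbitrary: t)
  case (Cons A Ts)
  then obtain u where "has_type (telescope Ts) u (A (length Ts))" by auto
  moreover have "subst 0 u T = T" using subst_lift[of 0 u T] assms(3) by simp
  ultimately show ?case using substitution Cons by fastforce
qed auto

text \<open>Lets a pair be assembled from components that were checked separately; the second has
  the unreduced type \<open>App B a\<close>.\<close>

lemma type_pair:
  assumes "has_type \<Gamma> A (U i)" "has_type \<Gamma> B (Pi A (U i))" "has_type \<Gamma> a A" "has_type \<Gamma> b (App B a)"
  shows "has_type \<Gamma> (apps cPair [A, B, a, b]) (apps cSigma [A, B])"
proof -
  have "ctx \<Gamma>" using assms(1) by (rule ctx_of_typing)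
  note type_Const[OF this, of cPair i]
  then have "has_type \<Gamma> (Const cPair) (Pi (U i) (Pi (Pi (Var 0) (U i)) (Pi (Var 1)
     (Pi (App (Var 1) (Var 0)) (App (App (Const cSigma) (Var 3)) (Var 2))))))"
    by (simp add: term_defs eval_nat_numeral)
  from type_App[OF this assms(1)]
  have "has_type \<Gamma> (apps cPair [A]) (Pi (Pi A (U i)) (Pi (lift 0 A)
     (Pi (App (Var 1) (Var 0)) (App (App (Const cSigma) (lift 0 (lift 0 (lift 0 A)))) (Var 2)))))"
    by (simp add: eval_nat_numeral)
  from type_App[OF this, simplified, OF assms(2)]
  have "has_type \<Gamma> (apps cPair [A, B]) (Pi A
     (Pi (App (lift 0 B) (Var 0)) (App (App (Const cSigma) (lift 0 (lift 0 A))) (lift 0 (lift 0 B)))))"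
    by (simp add: eval_nat_numeral subst_simps)
  from type_App[OF this, simplified, OF assms(3)]
  have "has_type \<Gamma> (apps cPair [A, B, a]) (Pi (App B a) (App (App (Const cSigma) (lift 0 A))
    (lift 0 B)))"
    by (simp add: subst_simps)
  from type_App[OF this, simplified, OF assms(4)] show ?thesis
    by (simp add: subst_lift)
qed

section \<open>Order-preserving maps acting on finite sets\<close>

abbreviation "UnitT \<equiv> \<langle>cUnit\<rangle>"
abbreviation "star \<equiv> \<langle>cStar\<rangle>"
abbreviation "EmptyT \<equiv> \<langle>cEmpty\<rangle>"
abbreviation "absurd C e \<equiv> \<langle>cIndEmpty\<rangle> \<cdot> (\<^bold>\<lambda>_. C) \<cdot> e"
abbreviation "maybe A \<equiv> \<langle>cSum\<rangle> \<cdot> UnitT \<cdot> A"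
abbreviation "inl_fn A \<equiv> \<langle>cInl\<rangle> \<cdot> UnitT \<cdot> A"
abbreviation "inr_fn A \<equiv> \<langle>cInr\<rangle> \<cdot> UnitT \<cdot> A"
abbreviation "ind_maybe A C f g s \<equiv> \<langle>cIndSum\<rangle> \<cdot> UnitT \<cdot> A \<cdot> lam C \<cdot> lam f \<cdot> lam g \<cdot> s"
abbreviation "ind_path A C c x y p \<equiv> \<langle>cIndId\<rangle> \<cdot> A \<cdot> (\<^bold>\<lambda>x. \<^bold>\<lambda>y. \<^bold>\<lambda>p. C x y p) \<cdot> lam c \<cdot> x \<cdot> y \<cdot> p"
abbreviation "ind_sigma A B C f p \<equiv> \<langle>cIndSigma\<rangle> \<cdot> A \<cdot> lam B \<cdot> lam C \<cdot> (\<^bold>\<lambda>a. \<^bold>\<lambda>b. f a b) \<cdot> p"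
abbreviation "ind_nat C z s n \<equiv> \<langle>cIndNat\<rangle> \<cdot> lam C \<cdot> z \<cdot> (\<^bold>\<lambda>n. \<^bold>\<lambda>h. s n h) \<cdot> n"
abbreviation "ind_ord C z sl sr m n f \<equiv> \<langle>cIndOrd\<rangle> \<cdot> (\<^bold>\<lambda>m. \<^bold>\<lambda>n. \<^bold>\<lambda>f. C m n f) \<cdot> z \<cdot>
  (\<^bold>\<lambda>m. \<^bold>\<lambda>n. \<^bold>\<lambda>f. \<^bold>\<lambda>h. sl m n f h)
  \<cdot> (\<^bold>\<lambda>m. \<^bold>\<lambda>n. \<^bold>\<lambda>f. \<^bold>\<lambda>h. sr m n f h) \<cdot> m \<cdot> n \<cdot> f"

definition [term_defs]: "is_prop A = (\<^bold>\<Pi>x:A. \<^bold>\<Pi>y:A. path A x y)"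
definition [term_defs]: "is_set A = (\<^bold>\<Pi>x:A. \<^bold>\<Pi>y:A. is_prop (path A x y))"

text \<open>\<open>ldiv A x y p z q\<close> is the concatenation of the inverse of \<open>p\<close> with \<open>q\<close>.\<close>

definition [term_defs]: "ldiv = (\<^bold>\<lambda>A. \<^bold>\<lambda>x. \<^bold>\<lambda>y. \<^bold>\<lambda>p. \<^bold>\<lambda>z. \<^bold>\<lambda>q.
   ind_path A (\<lambda>x y _. \<^bold>\<Pi>z:A. path A x z \<^bold>\<rightarrow> path A y z) (\<lambda>x. \<^bold>\<lambda>z. \<^bold>\<lambda>q. q) x y p \<cdot> z \<cdot> q)"
definition [term_defs]: "ldiv_type =
   (\<^bold>\<Pi>A:univ 1. \<^bold>\<Pi>x:A. \<^bold>\<Pi>y:A. path A x y \<^bold>\<rightarrow> (\<^bold>\<Pi>z:A. path A x z \<^bold>\<rightarrow> path A y z))"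

text \<open>
  The realisation is not part of the underlying data, so \<open>points n\<close> may stand in for \<open>Fin n\<close>. Being
  defined by recursion on \<open>n\<close>, it allows case analysis on \<open>points (n + 1)\<close> without generalising the
  index.
\<close>

definition [term_defs]: "points = (\<^bold>\<lambda>n. ind_nat (\<lambda>_. univ 0) EmptyT (\<lambda>_ A. maybe A) n)"
definition [term_defs]: "points_type = NatT \<^bold>\<rightarrow> univ 0"

definition [term_defs]: "act = (\<^bold>\<lambda>m. \<^bold>\<lambda>n. \<^bold>\<lambda>f. ind_ord (\<lambda>m n _. points \<cdot> m \<^bold>\<rightarrow> points \<cdot> n) (\<^bold>\<lambda>i. i)
   (\<lambda>m n f h. \<^bold>\<lambda>i. ind_maybe (points \<cdot> m) (\<lambda>_. points \<cdot> suc n) (\<lambda>u. inl_fn (points \<cdot> n) \<cdot> u)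
     (\<lambda>i. h \<cdot> i) i)
   (\<lambda>m n f h. \<^bold>\<lambda>i. inr_fn (points \<cdot> n) \<cdot> (h \<cdot> i)) m n f)"
definition [term_defs]: "act_type = (\<^bold>\<Pi>m:NatT. \<^bold>\<Pi>n:NatT. Ord m n \<^bold>\<rightarrow> points \<cdot> m \<^bold>\<rightarrow> points \<cdot> n)"

text \<open>
  If the least value is \<open>S k\<close>, a function that is not monotone may still take the value 0 elsewhere;
  \<open>k\<close> then serves as a default.
\<close>

definition [term_defs]: "unact =
   (\<^bold>\<lambda>m. \<^bold>\<lambda>n. \<^bold>\<lambda>b. ind_nat (\<lambda>m. \<^bold>\<Pi>n:NatT. (points \<cdot> m \<^bold>\<rightarrow> points \<cdot> n) \<^bold>\<rightarrow> Ord m n)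
   (\<^bold>\<lambda>n. \<^bold>\<lambda>_. ind_nat (\<lambda>n. Ord zero n) ord0 (\<lambda>n f. Sr zero n f) n)
   (\<lambda>m rm. \<^bold>\<lambda>n. ind_nat (\<lambda>n. (points \<cdot> suc m \<^bold>\<rightarrow> points \<cdot> n) \<^bold>\<rightarrow> Ord (suc m) n)
      (\<^bold>\<lambda>b. absurd (Ord (suc m) zero) (b \<cdot> (inl_fn (points \<cdot> m) \<cdot> star)))
      (\<lambda>n rn. \<^bold>\<lambda>b. ind_maybe (points \<cdot> n) (\<lambda>_. Ord (suc m) (suc n))
         (\<lambda>_. Sl m n (rm \<cdot> suc n \<cdot> (\<^bold>\<lambda>i. b \<cdot> (inr_fn (points \<cdot> m) \<cdot> i))))
         (\<lambda>k. Sr (suc m) n (rn \<cdot> (\<^bold>\<lambda>i. ind_maybe (points \<cdot> n) (\<lambda>_. points \<cdot> n) (\<lambda>_. k) (\<lambda>j. j) (b \<cdot> i))))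
         (b \<cdot> (inl_fn (points \<cdot> m) \<cdot> star))) n) m \<cdot> n \<cdot> b)"
definition [term_defs]: "unact_type = (\<^bold>\<Pi>m:NatT. \<^bold>\<Pi>n:NatT. (points \<cdot> m \<^bold>\<rightarrow> points \<cdot> n) \<^bold>\<rightarrow> Ord m n)"

text \<open>
  For \<open>k = m + 1\<close> this is the clause of \<open>act\<close> for \<open>S\<^sup>l\<close>. As in \<open>ord_comp_Sl\<close>, \<open>k\<close> is a variable so
  that induction on a term of \<open>Ord l k\<close> is possible; \<open>k = 0\<close> does not occur.
\<close>

definition [term_defs]: "extend =
   (\<^bold>\<lambda>n. \<^bold>\<lambda>k. \<^bold>\<lambda>e. \<^bold>\<lambda>i. ind_nat (\<lambda>k. (points \<cdot> (nat_pred \<cdot> k) \<^bold>\<rightarrow> points \<cdot> suc n) \<^bold>\<rightarrow> points \<cdot> k \<^bold>\<rightarrow>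
     points \<cdot> suc n)
   (\<^bold>\<lambda>e. \<^bold>\<lambda>i. absurd (points \<cdot> suc n) i)
   (\<lambda>k _. \<^bold>\<lambda>e. \<^bold>\<lambda>i. ind_maybe (points \<cdot> k) (\<lambda>_. points \<cdot> suc n) (\<lambda>u. inl_fn (points \<cdot> n) \<cdot> u)
     (\<lambda>i. e \<cdot> i) i) k \<cdot> e \<cdot> i)"
definition [term_defs]: "extend_type =
   (\<^bold>\<Pi>n:NatT. \<^bold>\<Pi>k:NatT. (points \<cdot> (nat_pred \<cdot> k) \<^bold>\<rightarrow> points \<cdot> suc n) \<^bold>\<rightarrow> points \<cdot> k \<^bold>\<rightarrow> points \<cdot> suc n)"

definition [term_defs]: "ord_comp_Sl_type =
   (\<^bold>\<Pi>n:NatT. \<^bold>\<Pi>a:NatT. \<^bold>\<Pi>b:NatT. Ord a b \<^bold>\<rightarrow> (\<^bold>\<Pi>p:NatT. Ord p (nat_pred \<cdot> b) \<^bold>\<rightarrow> Ord p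
     (suc n)) \<^bold>\<rightarrow> Ord a (suc n))"
definition [term_defs]: "ord_comp_type = (\<^bold>\<Pi>l:NatT. \<^bold>\<Pi>m:NatT. \<^bold>\<Pi>n:NatT. Ord m n \<^bold>\<rightarrow> Ord l m \<^bold>\<rightarrow> Ord l n)"

text \<open>The tables come in stages, since abstractions used inside others need their types on
  record: \<open>ord_comp\<close> relies on \<open>ord_comp_Sl\<close>, and \<open>act\<close> on
  \<open>points\<close>.\<close>

definition "defs0 = [(ord_comp_Sl 0, ord_comp_Sl_type 0), (ldiv 0, ldiv_type 0),
  (points 0, points_type 0)]"
definition "defs1 = [(ord_comp 0, ord_comp_type 0), (act 0, act_type 0), (unact 0, unact_type 0),
  (extend 0, extend_type 0)] @ defs0"

text \<open>
  The checker receives the tables as unapplied constants, so that the simplifier does not carry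
  their contents through every step.
\<close>

definition "table0 t = lookup defs0 t"
definition "table1 t = lookup defs1 t"

lemmas [code] = table0_def[unfolded defs0_def term_defs]
  table1_def[unfolded defs1_def defs0_def append.simps term_defs]

lemma well_typed_defs0: "\<forall>(t, T)\<in>set defs0. well_typed t T"
proof -
  have "check_def sig_env (\<lambda>_. None) [] (ord_comp_Sl 0) (ord_comp_Sl_type 0)"
    "check_def sig_env (\<lambda>_. None) [] (ldiv 0) (ldiv_type 0)"
    "check_def sig_env (\<lambda>_. None) [] (points 0) (points_type 0)"
    by (simp only: term_defs, code_simp)+
  then show ?thesis
    using well_typed_check_def[OF valid_sig_env, of "\<lambda>_. None"] by (simp add: defs0_def)
qed

lemma well_typed_table0: "\<forall>t T. table0 t = Some T \<longrightarrow> well_typed t T"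
  using well_typed_lookup[OF well_typed_defs0] by (simp add: table0_def)

lemma well_typed_defs1: "\<forall>(t, T)\<in>set defs1. well_typed t T"
proof -
  have "check_def sig_env table0 [] (ord_comp 0) (ord_comp_type 0)"
    "check_def sig_env table0 [] (act 0) (act_type 0)"
    "check_def sig_env table0 [] (unact 0) (unact_type 0)"
    "check_def sig_env table0 [] (extend 0) (extend_type 0)"
    by (simp only: term_defs, code_simp)+
  then show ?thesis
    using well_typed_check_def[OF valid_sig_env well_typed_table0] well_typed_defs0
    by (simp add: defs1_def)
qed

lemma well_typed_table1: "\<forall>t T. table1 t = Some T \<longrightarrow> well_typed t T"
  using well_typed_lookup[OF well_typed_defs1] by (simp add: table1_def)

lemma provable_Nil: "provable []"
  by simp

lemma provable_Cons:
  assumes "provable Ts" "check_def sig_env table1 (telescope Ts) (t (length Ts)) (T (length Ts))"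
  shows "provable (T # Ts)"
  using check_def_sound[OF valid_sig_env well_typed_table1 ctx_telescope[OF assms(1)] assms(2)] assms(1)
  by auto

section \<open>Path algebra, propositions and sets\<close>

definition [term_defs]: "ldiv_self_type =
   (\<^bold>\<Pi>A:univ 1. \<^bold>\<Pi>x:A. \<^bold>\<Pi>y:A. \<^bold>\<Pi>p:path A x y. path (path A y y) (ldiv \<cdot> A \<cdot> x \<cdot> y \<cdot> p \<cdot> y \<cdot> p)
     (refl_at A y))"
definition [term_defs]: "ldiv_self_proof = (\<^bold>\<lambda>A. \<^bold>\<lambda>x. \<^bold>\<lambda>y. \<^bold>\<lambda>p.
   ind_path A (\<lambda>x y p. path (path A y y) (ldiv \<cdot> A \<cdot> x \<cdot> y \<cdot> p \<cdot> y \<cdot> p) (refl_at A y))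
     (\<lambda>x. refl_at (path A x x) (refl_at A x)) x y p)"
abbreviation "ldiv_self \<equiv> bound_var 0"
abbreviation "ldiv_self_ctx \<equiv> ldiv_self_type # []"

lemma ldiv_self: "provable ldiv_self_ctx"
  by (rule provable_Cons[OF provable_Nil, where t = ldiv_self_proof]) (simp only: term_defs, code_simp)

definition [term_defs]: "ap_type =
   (\<^bold>\<Pi>A:univ 1. \<^bold>\<Pi>B:univ 1. \<^bold>\<Pi>f:A \<^bold>\<rightarrow> B. \<^bold>\<Pi>x:A. \<^bold>\<Pi>y:A. path A x y \<^bold>\<rightarrow> path B (f \<cdot> x) (f \<cdot> y))"
definition [term_defs]: "ap_proof = (\<^bold>\<lambda>A. \<^bold>\<lambda>B. \<^bold>\<lambda>f. \<^bold>\<lambda>x. \<^bold>\<lambda>y. \<^bold>\<lambda>p.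
   ind_path A (\<lambda>x y _. path B (f \<cdot> x) (f \<cdot> y)) (\<lambda>x. refl_at B (f \<cdot> x)) x y p)"
abbreviation "ap \<equiv> bound_var 1"
abbreviation "ap_ctx \<equiv> ap_type # ldiv_self_ctx"

lemma ap: "provable ap_ctx"
  by (rule provable_Cons[OF ldiv_self, where t = ap_proof]) (simp only: term_defs, code_simp)

text \<open>
  The paths \<open>s x y c\<close> below do not depend on \<open>c : R x y\<close>, and by path induction every \<open>p : x = y\<close>
  equals \<open>s x y c\<close>.
\<close>

definition [term_defs]: "set_of_rel_type =
   (\<^bold>\<Pi>A:univ 1. \<^bold>\<Pi>R:A \<^bold>\<rightarrow> A \<^bold>\<rightarrow> univ 1. (\<^bold>\<Pi>x:A. \<^bold>\<Pi>y:A. is_prop (R \<cdot> x \<cdot> y)) \<^bold>\<rightarrow>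
   (\<^bold>\<Pi>x:A. R \<cdot> x \<cdot> x) \<^bold>\<rightarrow> (\<^bold>\<Pi>x:A. \<^bold>\<Pi>y:A. R \<cdot> x \<cdot> y \<^bold>\<rightarrow> path A x y) \<^bold>\<rightarrow> is_set A)"
definition [term_defs]: "set_of_rel_proof = (\<^bold>\<lambda>A. \<^bold>\<lambda>R. \<^bold>\<lambda>h. \<^bold>\<lambda>\<rho>. \<^bold>\<lambda>f. \<^bold>\<lambda>x. \<^bold>\<lambda>y. \<^bold>\<lambda>p. \<^bold>\<lambda>q.
   (let s = (\<lambda>x y c. ldiv \<cdot> A \<cdot> x \<cdot> x \<cdot> (f \<cdot> x \<cdot> x \<cdot> (\<rho> \<cdot> x)) \<cdot> y \<cdot> (f \<cdot> x \<cdot> y \<cdot> c));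
        g = (\<lambda>p c. ind_path A (\<lambda>x y p. \<^bold>\<Pi>c:R \<cdot> x \<cdot> y. path (path A x y) (s x y c) p)
          (\<lambda>x. \<^bold>\<lambda>c. ind_path (R \<cdot> x \<cdot> x)
             (\<lambda>c0 c _. path (path A x x) (ldiv \<cdot> A \<cdot> x \<cdot> x \<cdot> (f \<cdot> x \<cdot> x \<cdot> c0) \<cdot> x \<cdot> (f \<cdot> x \<cdot> x \<cdot> c))
               (refl_at A x))
             (\<lambda>c. ldiv_self \<cdot> A \<cdot> x \<cdot> x \<cdot> (f \<cdot> x \<cdot> x \<cdot> c)) (\<rho> \<cdot> x) c (h \<cdot> x \<cdot> x \<cdot>
               (\<rho> \<cdot> x) \<cdot> c)) x y p \<cdot> c);
        c = ind_path A (\<lambda>x y _. R \<cdot> x \<cdot> y) (\<lambda>x. \<rho> \<cdot> x) x y p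
    in ldiv \<cdot> path A x y \<cdot> s x y c \<cdot> p \<cdot> g p c \<cdot> q \<cdot> g q c))"
abbreviation "set_of_rel \<equiv> bound_var 2"
abbreviation "set_of_rel_ctx \<equiv> set_of_rel_type # ap_ctx"

lemma set_of_rel: "provable set_of_rel_ctx"
  by (rule provable_Cons[OF ap, where t = set_of_rel_proof]) (simp only: term_defs, code_simp)

definition [term_defs]: "set_of_prop_type = (\<^bold>\<Pi>A:univ 1. is_prop A \<^bold>\<rightarrow> is_set A)"
definition [term_defs]: "set_of_prop_proof =
   (\<^bold>\<lambda>A. \<^bold>\<lambda>h. set_of_rel \<cdot> A \<cdot> (\<^bold>\<lambda>_. \<^bold>\<lambda>_. A) \<cdot> (\<^bold>\<lambda>_. \<^bold>\<lambda>_. h) \<cdot> (\<^bold>\<lambda>x. x) \<cdot> (\<^bold>\<lambda>x. \<^bold>\<lambda>y. \<^bold>\<lambda>_. h \<cdot> x \<cdot> y))"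
abbreviation "set_of_prop \<equiv> bound_var 3"
abbreviation "set_of_prop_ctx \<equiv> set_of_prop_type # set_of_rel_ctx"

text \<open>The constant relation with value \<open>A\<close> meets the criterion
  \<open>set_of_rel\<close>.\<close>

lemma set_of_prop: "provable set_of_prop_ctx"
  by (rule provable_Cons[OF set_of_rel, where t = set_of_prop_proof]) (simp only: term_defs, code_simp)

definition [term_defs]: "prop_retract_type =
   (\<^bold>\<Pi>A:univ 1. \<^bold>\<Pi>B:univ 1. \<^bold>\<Pi>s:A \<^bold>\<rightarrow> B. \<^bold>\<Pi>r:B \<^bold>\<rightarrow> A. (\<^bold>\<Pi>a:A. path A (r \<cdot> (s \<cdot> a)) a) \<^bold>\<rightarrow>
   is_prop B \<^bold>\<rightarrow> is_prop A)"
definition [term_defs]: "prop_retract_proof = (\<^bold>\<lambda>A. \<^bold>\<lambda>B. \<^bold>\<lambda>s. \<^bold>\<lambda>r. \<^bold>\<lambda>H. \<^bold>\<lambda>h. \<^bold>\<lambda>a. \<^bold>\<lambda>a'.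
   ldiv \<cdot> A \<cdot> (r \<cdot> (s \<cdot> a)) \<cdot> a \<cdot> (H \<cdot> a) \<cdot> a' \<cdot>
     (ldiv \<cdot> A \<cdot> (r \<cdot> (s \<cdot> a')) \<cdot> (r \<cdot> (s \<cdot> a)) \<cdot> (ap \<cdot> B \<cdot> A \<cdot> r \<cdot> (s \<cdot> a') \<cdot> (s \<cdot> a) \<cdot> (h \<cdot>
       (s \<cdot> a') \<cdot> (s \<cdot> a))) \<cdot> a' \<cdot> (H \<cdot> a')))"
abbreviation "prop_retract \<equiv> bound_var 4"
abbreviation "prop_retract_ctx \<equiv> prop_retract_type # set_of_prop_ctx"

text \<open>The required path is the chain \<open>a = r (s a) = r (s a') = a'\<close>.\<close>

lemma prop_retract: "provable prop_retract_ctx"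
  by (rule provable_Cons[OF set_of_prop, where t = prop_retract_proof]) (simp only: term_defs, code_simp)

text \<open>Takes the left inverse \<open>k\<close> of \<open>happly\<close>, with its homotopy, out of the equivalence given
  by \<open>cFunext\<close>.\<close>

definition [term_defs]: "funext_split C t = (\<^bold>\<lambda>A. \<^bold>\<lambda>B. \<^bold>\<lambda>f. \<^bold>\<lambda>g.
   (let P = path (\<^bold>\<Pi>x:A. B \<cdot> x) f g; Q = (\<^bold>\<Pi>x:A. path (B \<cdot> x) (f \<cdot> x) (g \<cdot> x)); e = happly A B f g;
        L = (\<^bold>\<Sigma>k:Q \<^bold>\<rightarrow> P. \<^bold>\<Pi>y:Q. path Q (e \<cdot> (k \<cdot> y)) y)
    in split_pair L (\<lambda>_. \<^bold>\<Sigma>k:Q \<^bold>\<rightarrow> P. \<^bold>\<Pi>x:P. path P (k \<cdot> (e \<cdot> x)) x) (C A B f g P Q)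
      (\<lambda>_ v. split_pair (Q \<^bold>\<rightarrow> P) (\<lambda>k. \<^bold>\<Pi>x:P. path P (k \<cdot> (e \<cdot> x)) x) (C A B f g P Q) (t A B f g P Q) v)
      (\<langle>cFunext\<rangle> \<cdot> A \<cdot> B \<cdot> f \<cdot> g)))"

definition [term_defs]: "funext_type =
   (\<^bold>\<Pi>A:univ 1. \<^bold>\<Pi>B:A \<^bold>\<rightarrow> univ 1. \<^bold>\<Pi>f:(\<^bold>\<Pi>x:A. B \<cdot> x). \<^bold>\<Pi>g:(\<^bold>\<Pi>x:A. B \<cdot> x).
   (\<^bold>\<Pi>x:A. path (B \<cdot> x) (f \<cdot> x) (g \<cdot> x)) \<^bold>\<rightarrow> path (\<^bold>\<Pi>x:A. B \<cdot> x) f g)"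
definition [term_defs]: "funext_proof = funext_split (\<lambda>A B f g P Q. Q \<^bold>\<rightarrow> P) (\<lambda>A B f g P Q k H. k)"
abbreviation "funext \<equiv> bound_var 5"
abbreviation "funext_ctx \<equiv> funext_type # prop_retract_ctx"

lemma funext: "provable funext_ctx"
  by (rule provable_Cons[OF prop_retract, where t = funext_proof]) (simp only: term_defs, code_simp)

definition [term_defs]: "prop_path_fun_type =
   (\<^bold>\<Pi>A:univ 1. \<^bold>\<Pi>B:A \<^bold>\<rightarrow> univ 1. \<^bold>\<Pi>f:(\<^bold>\<Pi>x:A. B \<cdot> x). \<^bold>\<Pi>g:(\<^bold>\<Pi>x:A. B \<cdot> x).
   (\<^bold>\<Pi>x:A. is_prop (path (B \<cdot> x) (f \<cdot> x) (g \<cdot> x))) \<^bold>\<rightarrow> is_prop (path (\<^bold>\<Pi>x:A. B \<cdot> x) f g))"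
definition [term_defs]: "prop_path_fun_proof =
   funext_split (\<lambda>A B f g P Q. (\<^bold>\<Pi>x:A. is_prop (path (B \<cdot> x) (f \<cdot> x) (g \<cdot> x))) \<^bold>\<rightarrow> is_prop P)
   (\<lambda>A B f g P Q k H. \<^bold>\<lambda>h. prop_retract \<cdot> P \<cdot> Q \<cdot> happly A B f g \<cdot> k \<cdot> H \<cdot>
      (\<^bold>\<lambda>u. \<^bold>\<lambda>v. funext \<cdot> A \<cdot> (\<^bold>\<lambda>x. path (B \<cdot> x) (f \<cdot> x) (g \<cdot> x)) \<cdot> u \<cdot> v \<cdot> (\<^bold>\<lambda>x. h \<cdot> x \<cdot> (u \<cdot> x) \<cdot>
        (v \<cdot> x))))"
abbreviation "prop_path_fun \<equiv> bound_var 6"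
abbreviation "prop_path_fun_ctx \<equiv> prop_path_fun_type # funext_ctx"

text \<open>\<open>happly\<close> makes paths between functions a retract of families of pointwise
  paths, and by \<open>funext\<close> these families form a proposition.\<close>

lemma prop_path_fun: "provable prop_path_fun_ctx"
  by (rule provable_Cons[OF funext, where t = prop_path_fun_proof]) (simp only: term_defs, code_simp)

section \<open>The realisations are sets\<close>

definition [term_defs]: "prop_unit_type = is_prop UnitT"
definition [term_defs]: "prop_unit_proof = (\<^bold>\<lambda>x. \<^bold>\<lambda>y. \<langle>cIndUnit\<rangle> \<cdot> (\<^bold>\<lambda>x. path UnitT x y) \<cdot>
   (\<langle>cIndUnit\<rangle> \<cdot> (\<^bold>\<lambda>y. path UnitT star y) \<cdot> refl_at UnitT star \<cdot> y) \<cdot> x)"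
abbreviation "prop_unit \<equiv> bound_var 7"
abbreviation "prop_unit_ctx \<equiv> prop_unit_type # prop_path_fun_ctx"

lemma prop_unit: "provable prop_unit_ctx"
  by (rule provable_Cons[OF prop_path_fun, where t = prop_unit_proof]) (simp only: term_defs, code_simp)

definition [term_defs]: "prop_empty_type = is_prop EmptyT"
definition [term_defs]: "prop_empty_proof = (\<^bold>\<lambda>x. \<^bold>\<lambda>y. absurd (path EmptyT x y) x)"
abbreviation "prop_empty \<equiv> bound_var 8"
abbreviation "prop_empty_ctx \<equiv> prop_empty_type # prop_unit_ctx"

lemma prop_empty: "provable prop_empty_ctx"
  by (rule provable_Cons[OF prop_unit, where t = prop_empty_proof]) (simp only: term_defs, code_simp)

text \<open>The code family for equality in \<open>1 + A\<close>: equal tags give \<open>1\<close>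
  or a path in \<open>A\<close>, different tags give \<open>0\<close>.\<close>

definition [term_defs]: "maybe_rel A s t = ind_maybe A (\<lambda>_. univ 1)
   (\<lambda>_. ind_maybe A (\<lambda>_. univ 1) (\<lambda>_. UnitT) (\<lambda>_. EmptyT) t)
   (\<lambda>a. ind_maybe A (\<lambda>_. univ 1) (\<lambda>_. EmptyT) (\<lambda>b. path A a b) t) s"

definition [term_defs]: "set_maybe_type = (\<^bold>\<Pi>A:univ 0. is_set A \<^bold>\<rightarrow> is_set (maybe A))"
definition [term_defs]: "set_maybe_proof = (\<^bold>\<lambda>A. \<^bold>\<lambda>h.
  (let P = path (maybe A); il = (\<lambda>u. inl_fn A \<cdot> u); ir = (\<lambda>a. inr_fn A \<cdot> a); R = maybe_rel A in
   set_of_rel \<cdot> maybe A \<cdot> (\<^bold>\<lambda>s. \<^bold>\<lambda>t. R s t)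
   \<cdot> (\<^bold>\<lambda>s. \<^bold>\<lambda>t. ind_maybe A (\<lambda>s. is_prop (R s t))
        (\<lambda>u. ind_maybe A (\<lambda>t. is_prop (R (il u) t)) (\<lambda>_. prop_unit) (\<lambda>_. prop_empty) t)
        (\<lambda>a. ind_maybe A (\<lambda>t. is_prop (R (ir a) t)) (\<lambda>_. prop_empty) (\<lambda>b. h \<cdot> a \<cdot> b) t) s)
   \<cdot> (\<^bold>\<lambda>s. ind_maybe A (\<lambda>s. R s s) (\<lambda>_. star) (\<lambda>a. refl_at A a) s)
   \<cdot> (\<^bold>\<lambda>s. \<^bold>\<lambda>t. ind_maybe A (\<lambda>s. R s t \<^bold>\<rightarrow> P s t)
        (\<lambda>u. ind_maybe A (\<lambda>t. R (il u) t \<^bold>\<rightarrow> P (il u) t)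
           (\<lambda>v. \<^bold>\<lambda>_. ap \<cdot> UnitT \<cdot> maybe A \<cdot> inl_fn A \<cdot> u \<cdot> v \<cdot> (prop_unit \<cdot> u \<cdot> v))
           (\<lambda>b. \<^bold>\<lambda>e. absurd (P (il u) (ir b)) e) t)
        (\<lambda>a. ind_maybe A (\<lambda>t. R (ir a) t \<^bold>\<rightarrow> P (ir a) t)
           (\<lambda>v. \<^bold>\<lambda>e. absurd (P (ir a) (il v)) e)
           (\<lambda>b. \<^bold>\<lambda>e. ap \<cdot> A \<cdot> maybe A \<cdot> inr_fn A \<cdot> a \<cdot> b \<cdot> e) t) s)))"
abbreviation "set_maybe \<equiv> bound_var 9"
abbreviation "set_maybe_ctx \<equiv> set_maybe_type # prop_empty_ctx"

text \<open>Instance of \<open>set_of_rel\<close> for the codes: they are propositions because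
  \<open>A\<close> is a set, and they imply equality by applying the injections to paths.\<close>

lemma set_maybe: "provable set_maybe_ctx"
  by (rule provable_Cons[OF prop_empty, where t = set_maybe_proof]) (simp only: term_defs, code_simp)

definition [term_defs]: "set_points_type = (\<^bold>\<Pi>n:NatT. is_set (points \<cdot> n))"
definition [term_defs]: "set_points_proof = (\<^bold>\<lambda>n. ind_nat (\<lambda>n. is_set (points \<cdot> n))
   (\<^bold>\<lambda>x. \<^bold>\<lambda>y. absurd (is_prop (path EmptyT x y)) x) (\<lambda>n h. set_maybe \<cdot> (points \<cdot> n) \<cdot> h) n)"
abbreviation "set_points \<equiv> bound_var 10"
abbreviation "set_points_ctx \<equiv> set_points_type # set_maybe_ctx"

lemma set_points: "provable set_points_ctx"
  by (rule provable_Cons[OF set_maybe, where t = set_points_proof]) (simp only: term_defs, code_simp)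

section \<open>Fibres of maps with a left inverse\<close>

definition [term_defs]: "prop_fibre_type =
   (\<^bold>\<Pi>A:univ 1. \<^bold>\<Pi>B:univ 1. \<^bold>\<Pi>s:A \<^bold>\<rightarrow> B. \<^bold>\<Pi>r:B \<^bold>\<rightarrow> A. (\<^bold>\<Pi>a:A. path A (r \<cdot> (s \<cdot> a)) a) \<^bold>\<rightarrow>
   is_set B \<^bold>\<rightarrow> (\<^bold>\<Pi>b:B. is_prop (fibre A B s b)))"
definition [term_defs]: "prop_fibre_proof = (\<^bold>\<lambda>A. \<^bold>\<lambda>B. \<^bold>\<lambda>s. \<^bold>\<lambda>r. \<^bold>\<lambda>H. \<^bold>\<lambda>h. \<^bold>\<lambda>b. \<^bold>\<lambda>x. \<^bold>\<lambda>y.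
   (let F = fibre A B s b; P = (\<lambda>a. path B (s \<cdot> a) b); pr = (\<lambda>a. \<langle>cPair\<rangle> \<cdot> A \<cdot> lam P \<cdot> a);
        q = (\<lambda>a p. ldiv \<cdot> A \<cdot> (r \<cdot> (s \<cdot> a)) \<cdot> (r \<cdot> b) \<cdot> (ap \<cdot> B \<cdot> A \<cdot> r \<cdot> (s \<cdot> a) \<cdot> b \<cdot> p) \<cdot> a \<cdot> (H \<cdot> a))
    in ind_sigma A P (\<lambda>x. \<^bold>\<Pi>y:F. path F x y)
      (\<lambda>a p. \<^bold>\<lambda>y. ind_sigma A P (\<lambda>y. path F (pr a \<cdot> p) y)
         (\<lambda>a' p'. ind_path A (\<lambda>a a' _. \<^bold>\<Pi>p:P a. \<^bold>\<Pi>p':P a'. path F (pr a \<cdot> p) (pr a' \<cdot> p'))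
            (\<lambda>a. \<^bold>\<lambda>p. \<^bold>\<lambda>p'. ap \<cdot> P a \<cdot> F \<cdot> pr a \<cdot> p \<cdot> p' \<cdot> (h \<cdot> (s \<cdot> a) \<cdot> b \<cdot> p \<cdot> p'))
            a a' (ldiv \<cdot> A \<cdot> (r \<cdot> b) \<cdot> a \<cdot> q a p \<cdot> a' \<cdot> q a' p') \<cdot> p \<cdot> p') y) x \<cdot> y))"
abbreviation "prop_fibre \<equiv> bound_var 11"
abbreviation "prop_fibre_ctx \<equiv> prop_fibre_type # set_points_ctx"

text \<open>For points \<open>(a, p)\<close> and \<open>(a', p')\<close>, the paths
  \<open>q a p : r b = a\<close> and \<open>q a' p' : r b = a'\<close> join \<open>a\<close> to
  \<open>a'\<close>. After path induction on this path, \<open>p = p'\<close> holds because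
  \<open>B\<close> is a set.\<close>

lemma prop_fibre: "provable prop_fibre_ctx"
  by (rule provable_Cons[OF set_points, where t = prop_fibre_proof]) (simp only: term_defs, code_simp)

definition [term_defs]: "contr_path_type = (\<^bold>\<Pi>A:univ 1. is_prop A \<^bold>\<rightarrow> truncated 1 A)"
definition [term_defs]: "contr_path_proof =
   (\<^bold>\<lambda>A. \<^bold>\<lambda>h. \<^bold>\<lambda>x. \<^bold>\<lambda>y. pair (path A x y) (\<lambda>c. \<^bold>\<Pi>p:path A x y. path (path A x y) c p)
   (h \<cdot> x \<cdot> y) (\<^bold>\<lambda>p. set_of_prop \<cdot> A \<cdot> h \<cdot> x \<cdot> y \<cdot> (h \<cdot> x \<cdot> y) \<cdot> p))"
abbreviation "contr_path \<equiv> bound_var 12"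
abbreviation "contr_path_ctx \<equiv> contr_path_type # prop_fibre_ctx"

text \<open>\<open>truncated 1\<close> asks for contractible path types: \<open>h x y\<close> is the
  centre, and the contraction exists because a proposition is a set.\<close>

lemma contr_path: "provable contr_path_ctx"
  by (rule provable_Cons[OF prop_fibre, where t = contr_path_proof]) (simp only: term_defs, code_simp)

section \<open>The action on points: left inverse, identities, composition\<close>

definition [term_defs]: "unact_act_type =
   (\<^bold>\<Pi>m:NatT. \<^bold>\<Pi>n:NatT. \<^bold>\<Pi>f:Ord m n. path (Ord m n) (unact \<cdot> m \<cdot> n \<cdot> (act \<cdot> m \<cdot> n \<cdot> f)) f)"
definition [term_defs]: "unact_act_proof =
   (let P = (\<lambda>m n f. path (Ord m n) (unact \<cdot> m \<cdot> n \<cdot> (act \<cdot> m \<cdot> n \<cdot> f)) f);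
    ap_Sr = (\<lambda>m n f h. ap \<cdot> Ord m n \<cdot> Ord m (suc n) \<cdot> (\<langle>cOSr\<rangle> \<cdot> m \<cdot> n) \<cdot> (unact \<cdot> m \<cdot> n \<cdot>
      (act \<cdot> m \<cdot> n \<cdot> f)) \<cdot> f \<cdot> h) in
  (\<^bold>\<lambda>m. \<^bold>\<lambda>n. \<^bold>\<lambda>f. ind_ord P (refl_at (Ord zero zero) ord0)
    (\<lambda>m n f h. ap \<cdot> Ord m (suc n) \<cdot> Ord (suc m) (suc n) \<cdot> (\<langle>cOSl\<rangle> \<cdot> m \<cdot> n) \<cdot> (unact \<cdot> m \<cdot> suc n \<cdot>
      (act \<cdot> m \<cdot> suc n \<cdot> f)) \<cdot> f \<cdot> h)
    (\<lambda>m n f h. ind_nat (\<lambda>m. \<^bold>\<Pi>f:Ord m n. P m n f \<^bold>\<rightarrow> P m (suc n) (Sr m n f))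
       (\<^bold>\<lambda>f. \<^bold>\<lambda>h. ap_Sr zero n f h) (\<lambda>m _. \<^bold>\<lambda>f. \<^bold>\<lambda>h. ap_Sr (suc m) n f h) m \<cdot> f \<cdot> h) m n f))"
abbreviation "unact_act \<equiv> bound_var 13"
abbreviation "unact_act_ctx \<equiv> unact_act_type # contr_path_ctx"

text \<open>On a constructor, \<open>unact\<close> after \<open>act\<close> computes to that
  constructor applied to the recursive value, so the induction hypothesis is used under it. For
  \<open>Sr\<close> the index \<open>m\<close> must be split first, because \<open>unact\<close>
  recurses on \<open>m\<close> before \<open>n\<close>.\<close>

lemma unact_act: "provable unact_act_ctx"
  by (rule provable_Cons[OF contr_path, where t = unact_act_proof]) (simp only: term_defs, code_simp)

definition [term_defs]: "act_id_type =
   (\<^bold>\<Pi>n:NatT. path (points \<cdot> n \<^bold>\<rightarrow> points \<cdot> n) (act \<cdot> n \<cdot> n \<cdot> (ord_id \<cdot> n)) (\<^bold>\<lambda>a. a))"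
definition [term_defs]: "act_id_proof =
   (\<^bold>\<lambda>n. funext \<cdot> (points \<cdot> n) \<cdot> (\<^bold>\<lambda>_. points \<cdot> n) \<cdot> (act \<cdot> n \<cdot> n \<cdot> (ord_id \<cdot> n)) \<cdot> (\<^bold>\<lambda>a. a) \<cdot>
   (let P = (\<lambda>n i. path (points \<cdot> n) (act \<cdot> n \<cdot> n \<cdot> (ord_id \<cdot> n) \<cdot> i) i) in
    ind_nat (\<lambda>n. \<^bold>\<Pi>i:points \<cdot> n. P n i) (\<^bold>\<lambda>i. refl_at (points \<cdot> zero) i)
      (\<lambda>n h. \<^bold>\<lambda>i. ind_maybe (points \<cdot> n) (\<lambda>i. P (suc n) i) (\<lambda>u. refl_at (points \<cdot> suc n) (inl_fn
        (points \<cdot> n) \<cdot> u))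
         (\<lambda>i. ap \<cdot> (points \<cdot> n) \<cdot> (points \<cdot> suc n) \<cdot> inr_fn (points \<cdot> n) \<cdot> (act \<cdot> n \<cdot> n \<cdot>
           (ord_id \<cdot> n) \<cdot> i) \<cdot> i \<cdot> (h \<cdot> i)) i) n))"
abbreviation "act_id \<equiv> bound_var 14"
abbreviation "act_id_ctx \<equiv> act_id_type # unact_act_ctx"

text \<open>By \<open>funext\<close> and induction on \<open>n\<close>: the identity at
  \<open>n + 1\<close> is \<open>Sl\<close> of \<open>Sr\<close>, which fixes the least point and
  acts on the others as \<open>inr\<close> after the smaller identity.\<close>

lemma act_id: "provable act_id_ctx"
  by (rule provable_Cons[OF unact_act, where t = act_id_proof]) (simp only: term_defs, code_simp)

text \<open>Here \<open>c\<close> stands for composition with some map and \<open>e\<close> for the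
  action of that map. If \<open>e\<close> realises \<open>c\<close>, then \<open>extend\<close> of
  \<open>e\<close> realises \<open>ord_comp_Sl\<close> with \<open>c\<close>.\<close>

definition [term_defs]: "act_comp_Sl_motive n =
   (\<lambda>l k f. \<^bold>\<Pi>c:(\<^bold>\<Pi>p:NatT. Ord p (nat_pred \<cdot> k) \<^bold>\<rightarrow> Ord p (suc n)).
   \<^bold>\<Pi>e:points \<cdot> (nat_pred \<cdot> k) \<^bold>\<rightarrow> points \<cdot> suc n.
   (\<^bold>\<Pi>p:NatT. \<^bold>\<Pi>f:Ord p (nat_pred \<cdot> k). \<^bold>\<Pi>i:points \<cdot> p.
      path (points \<cdot> suc n) (act \<cdot> p \<cdot> suc n \<cdot> (c \<cdot> p \<cdot> f) \<cdot> i) (e \<cdot> (act \<cdot> p \<cdot>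
        (nat_pred \<cdot> k) \<cdot> f \<cdot> i))) \<^bold>\<rightarrow>
   (\<^bold>\<Pi>i:points \<cdot> l. path (points \<cdot> suc n) (act \<cdot> l \<cdot> suc n \<cdot> (ord_comp_Sl \<cdot> n \<cdot> l \<cdot> k \<cdot> f \<cdot> c) \<cdot> i)
      (extend \<cdot> n \<cdot> k \<cdot> e \<cdot> (act \<cdot> l \<cdot> k \<cdot> f \<cdot> i))))"
definition [term_defs]: "act_comp_Sl_type =
   (\<^bold>\<Pi>n:NatT. \<^bold>\<Pi>l:NatT. \<^bold>\<Pi>k:NatT. \<^bold>\<Pi>f:Ord l k. act_comp_Sl_motive n l k f)"
definition [term_defs]: "act_comp_Sl_proof = (\<^bold>\<lambda>n. \<^bold>\<lambda>l. \<^bold>\<lambda>k. \<^bold>\<lambda>f. ind_ord (act_comp_Sl_motive n)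
   (\<^bold>\<lambda>c. \<^bold>\<lambda>e. \<^bold>\<lambda>h. \<^bold>\<lambda>i. absurd (path (points \<cdot> suc n) (act \<cdot> zero \<cdot> suc n \<cdot>
     (ord_comp_Sl \<cdot> n \<cdot> zero \<cdot> zero \<cdot> ord0 \<cdot> c) \<cdot> i)
      (extend \<cdot> n \<cdot> zero \<cdot> e \<cdot> (act \<cdot> zero \<cdot> zero \<cdot> ord0 \<cdot> i))) i)
   (\<lambda>a b f rec. \<^bold>\<lambda>c. \<^bold>\<lambda>e. \<^bold>\<lambda>h. \<^bold>\<lambda>i. ind_maybe (points \<cdot> a)
      (\<lambda>i. path (points \<cdot> suc n) (act \<cdot> suc a \<cdot> suc n \<cdot>
        (ord_comp_Sl \<cdot> n \<cdot> suc a \<cdot> suc b \<cdot> Sl a b f \<cdot> c) \<cdot> i)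
      (extend \<cdot> n \<cdot> suc b \<cdot> e \<cdot> (act \<cdot> suc a \<cdot> suc b \<cdot> Sl a b f \<cdot> i)))
      (\<lambda>u. refl_at (points \<cdot> suc n) (inl_fn (points \<cdot> n) \<cdot> u)) (\<lambda>i. rec \<cdot> c \<cdot> e \<cdot> h \<cdot> i) i)
   (\<lambda>a b f rec. \<^bold>\<lambda>c. \<^bold>\<lambda>e. \<^bold>\<lambda>h. \<^bold>\<lambda>i. h \<cdot> a \<cdot> f \<cdot> i) l k f)"
abbreviation "act_comp_Sl \<equiv> bound_var 15"
abbreviation "act_comp_Sl_ctx \<equiv> act_comp_Sl_type # act_id_ctx"

text \<open>Induction on \<open>f\<close>: at \<open>ord0\<close> there is no point
  \<open>i\<close>; at \<open>Sl\<close> the least point is fixed on both sides and the others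
  follow by induction; at \<open>Sr\<close> both sides compute to the assumption relating
  \<open>c\<close> and \<open>e\<close>.\<close>

lemma act_comp_Sl: "provable act_comp_Sl_ctx"
  by (rule provable_Cons[OF act_id, where t = act_comp_Sl_proof]) (simp only: term_defs, code_simp)

definition [term_defs]: "act_comp_type = (\<^bold>\<Pi>l:NatT. \<^bold>\<Pi>m:NatT. \<^bold>\<Pi>n:NatT. \<^bold>\<Pi>g:Ord m n. \<^bold>\<Pi>f:Ord l m.
   path (points \<cdot> l \<^bold>\<rightarrow> points \<cdot> n) (act \<cdot> l \<cdot> n \<cdot> (ord_comp \<cdot> l \<cdot> m \<cdot> n \<cdot> g \<cdot> f))
     (\<^bold>\<lambda>a. act \<cdot> m \<cdot> n \<cdot> g \<cdot> (act \<cdot> l \<cdot> m \<cdot> f \<cdot> a)))"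
definition [term_defs]: "act_comp_proof =
   (let c = (\<lambda>l m n g f i. act \<cdot> l \<cdot> n \<cdot> (ord_comp \<cdot> l \<cdot> m \<cdot> n \<cdot> g \<cdot> f) \<cdot> i);
    d = (\<lambda>l m n g f i. act \<cdot> m \<cdot> n \<cdot> g \<cdot> (act \<cdot> l \<cdot> m \<cdot> f \<cdot> i)) in
  (\<^bold>\<lambda>l. \<^bold>\<lambda>m. \<^bold>\<lambda>n. \<^bold>\<lambda>g. \<^bold>\<lambda>f. funext \<cdot> (points \<cdot> l) \<cdot> (\<^bold>\<lambda>_. points \<cdot> n) \<cdot> (act \<cdot> l \<cdot> n \<cdot>
    (ord_comp \<cdot> l \<cdot> m \<cdot> n \<cdot> g \<cdot> f))
    \<cdot> (\<^bold>\<lambda>a. act \<cdot> m \<cdot> n \<cdot> g \<cdot> (act \<cdot> l \<cdot> m \<cdot> f \<cdot> a)) \<cdot>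
    (ind_ord (\<lambda>m n g. \<^bold>\<Pi>l:NatT. \<^bold>\<Pi>f:Ord l m. \<^bold>\<Pi>i:points \<cdot> l. path (points \<cdot> n) (c l m n g f i)
      (d l m n g f i))
      (\<^bold>\<lambda>l. \<^bold>\<lambda>f. \<^bold>\<lambda>i. refl_at (points \<cdot> zero) (act \<cdot> l \<cdot> zero \<cdot> f \<cdot> i))
      (\<lambda>m n g h. \<^bold>\<lambda>l. \<^bold>\<lambda>f. \<^bold>\<lambda>i. act_comp_Sl \<cdot> n \<cdot> l \<cdot> suc m \<cdot> f \<cdot>
        (\<^bold>\<lambda>p. \<^bold>\<lambda>f. ord_comp \<cdot> p \<cdot> m \<cdot> suc n \<cdot> g \<cdot> f) \<cdot> (act \<cdot> m \<cdot> suc n \<cdot> g) \<cdot> h \<cdot> i)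
      (\<lambda>m n g h. \<^bold>\<lambda>l. \<^bold>\<lambda>f. \<^bold>\<lambda>i. ap \<cdot> (points \<cdot> n) \<cdot> (points \<cdot> suc n) \<cdot> inr_fn
        (points \<cdot> n) \<cdot> c l m n g f i \<cdot> d l m n g f i \<cdot> (h \<cdot> l \<cdot> f \<cdot> i))
      m n g \<cdot> l \<cdot> f)))"
abbreviation "act_comp \<equiv> bound_var 16"
abbreviation "act_comp_ctx \<equiv> act_comp_type # act_comp_Sl_ctx"

text \<open>By \<open>funext\<close> and induction on \<open>g\<close>. For \<open>Sl\<close>, take
  in \<open>act_comp_Sl\<close> composition with the smaller map and its action;
  \<open>extend\<close> of this action computes to the action of \<open>Sl\<close>. For
  \<open>Sr\<close>, both sides gain an \<open>inr\<close>.\<close>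

lemma act_comp: "provable act_comp_ctx"
  by (rule provable_Cons[OF act_comp_Sl, where t = act_comp_proof]) (simp only: term_defs, code_simp)

section \<open>Assembling the concrete category\<close>

definition [term_defs]: "hom_fn = (\<^bold>\<lambda>m. \<^bold>\<lambda>n. Ord (suc m) (suc n))"
definition [term_defs]: "objp_fn = (\<^bold>\<lambda>n. points \<cdot> suc n)"
definition [term_defs]: "homp_fn = (\<^bold>\<lambda>m. \<^bold>\<lambda>n. act \<cdot> suc m \<cdot> suc n)"

definition [term_defs]: "conf_simplex_type = conf_type NatT objp_fn hom_fn homp_fn"
definition [term_defs]: "conf_simplex_proof =
   (\<^bold>\<lambda>x. \<^bold>\<lambda>y. \<^bold>\<lambda>b. contr_path \<cdot> fibre (Ord (suc x) (suc y)) (points \<cdot> suc x \<^bold>\<rightarrow> points \<cdot> suc y)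
     (act \<cdot> suc x \<cdot> suc y) b \<cdot>
   (prop_fibre \<cdot> Ord (suc x) (suc y) \<cdot> (points \<cdot> suc x \<^bold>\<rightarrow> points \<cdot> suc y) \<cdot> (act \<cdot> suc x \<cdot> suc y) \<cdot>
     (unact \<cdot> suc x \<cdot> suc y) \<cdot> (unact_act \<cdot> suc x \<cdot> suc y) \<cdot>
     (\<^bold>\<lambda>f. \<^bold>\<lambda>g. prop_path_fun \<cdot> (points \<cdot> suc x) \<cdot> (\<^bold>\<lambda>_. points \<cdot> suc y) \<cdot> f \<cdot> g \<cdot>
       (\<^bold>\<lambda>i. set_points \<cdot> suc y \<cdot> (f \<cdot> i) \<cdot> (g \<cdot> i))) \<cdot> b))"
abbreviation "conf_simplex \<equiv> bound_var 17"
abbreviation "conf_simplex_ctx \<equiv> conf_simplex_type # act_comp_ctx"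

lemma conf_simplex: "provable conf_simplex_ctx"
  by (rule provable_Cons[OF act_comp, where t = conf_simplex_proof]) (simp only: term_defs, code_simp)

definition [term_defs]: "simplex_ident' idp =
   (\<^bold>\<lambda>x. pair (hom_fn \<cdot> x \<cdot> x) (\<lambda>h. path (objp_fn \<cdot> x \<^bold>\<rightarrow> objp_fn \<cdot> x) (homp_fn \<cdot> x \<cdot> x \<cdot> h) (\<^bold>\<lambda>a. a))
   (ord_id \<cdot> suc x) (idp \<cdot> suc x))"
definition [term_defs]: "simplex_cmp' cmpp = (\<^bold>\<lambda>x. \<^bold>\<lambda>y. \<^bold>\<lambda>z. \<^bold>\<lambda>g. \<^bold>\<lambda>f. pair (hom_fn \<cdot> x \<cdot> z)
   (\<lambda>h. path (objp_fn \<cdot> x \<^bold>\<rightarrow> objp_fn \<cdot> z) (homp_fn \<cdot> x \<cdot> z \<cdot> h) (\<^bold>\<lambda>a. homp_fn \<cdot> y \<cdot> z \<cdot> g \<cdot>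
     (homp_fn \<cdot> x \<cdot> y \<cdot> f \<cdot> a)))
   (ord_comp \<cdot> suc x \<cdot> suc y \<cdot> suc z \<cdot> g \<cdot> f) (cmpp \<cdot> suc x \<cdot> suc y \<cdot> suc z \<cdot> g \<cdot> f))"
text \<open>Abstracting over the three proofs yields a closed term, which is checked once and
  recorded in a table.\<close>

definition [term_defs]: "simplex_cat = (\<^bold>\<lambda>conf. \<^bold>\<lambda>idp. \<^bold>\<lambda>cmpp.
   pair (univ 0) (\<lambda>obj. from_objp 0 obj) NatT (
   pair (NatT \<^bold>\<rightarrow> univ 0) (\<lambda>objp. from_hom 0 NatT objp) objp_fn (
   pair (NatT \<^bold>\<rightarrow> NatT \<^bold>\<rightarrow> univ 0) (\<lambda>hom. from_homp NatT objp_fn hom) hom_fn (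
   pair (homp_type NatT objp_fn hom_fn) (\<lambda>homp. from_conf NatT objp_fn hom_fn homp) homp_fn (
   pair (conf_type NatT objp_fn hom_fn homp_fn)
     (\<lambda>_. ident'_type NatT objp_fn hom_fn homp_fn \<^bold>\<times> cmp'_type NatT objp_fn hom_fn homp_fn) conf (
   pair (ident'_type NatT objp_fn hom_fn homp_fn) (\<lambda>_. cmp'_type NatT objp_fn hom_fn homp_fn)
     (simplex_ident' idp) (simplex_cmp' cmpp)))))))"
definition [term_defs]: "simplex_cat_type =
   conf_simplex_type \<^bold>\<rightarrow> act_id_type \<^bold>\<rightarrow> act_comp_type \<^bold>\<rightarrow> concrete_cat 0"

definition [term_defs]: "goal_fn = (\<^bold>\<lambda>C. path (cat_data 0) (underlying 0 C) (simplex_data 0))"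
definition [term_defs]: "goal_fn_type = concrete_cat 0 \<^bold>\<rightarrow> univ 1"

abbreviation "the_cat \<equiv> simplex_cat \<cdot> conf_simplex \<cdot> act_id \<cdot> act_comp"
abbreviation "the_path \<equiv> refl_at (cat_data 0) (simplex_data 0)"

definition "defs2 = [(goal_fn 0, goal_fn_type 0), (simplex_cat 0, simplex_cat_type 0)] @ defs1"
definition "table2 t = lookup defs2 t"

lemmas [code] = table2_def[unfolded defs2_def defs1_def defs0_def append.simps term_defs]

lemma check_simplex_cat: "check_def sig_env table1 [] (simplex_cat 0) (simplex_cat_type 0)"
  by (simp only: term_defs, code_simp)

lemma check_concrete_cat: "check_def sig_env table1 [] (concrete_cat 0 0) (U 1)"
  by (simp only: term_defs, code_simp)

lemma check_goal_fn: "check_def sig_env table1 [] (goal_fn 0) (goal_fn_type 0)"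
  by (simp only: term_defs, code_simp)

lemma well_typed_defs2: "\<forall>(t, T)\<in>set defs2. well_typed t T"
  using well_typed_check_def[OF valid_sig_env well_typed_table1] check_simplex_cat check_goal_fn
    well_typed_defs1
  by (simp add: defs2_def)

lemma well_typed_table2: "\<forall>t T. table2 t = Some T \<longrightarrow> well_typed t T"
  using well_typed_lookup[OF well_typed_defs2] by (simp add: table2_def)

abbreviation "final_ctx \<equiv> telescope conf_simplex_ctx"

text \<open>The number 18 counts the opaque lemmas and is thus the depth at which terms over
  \<open>final_ctx\<close> are built.\<close>

lemma check_the_cat: "check_def sig_env table2 final_ctx (the_cat 18) (concrete_cat 0 18)"
  by (simp only: term_defs, code_simp)

text \<open>Reflexivity is accepted because \<open>underlying\<close> takes the nested pairs apart
  by computation: projecting from \<open>simplex_ident'\<close> and \<open>simplex_cmp'\<close>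
  yields \<open>ord_id\<close> and \<open>ord_comp\<close>, while the proofs, here variables, are
  discarded.\<close>

lemma check_the_path: "check_def sig_env table2 final_ctx (the_path 18) ((goal_fn \<cdot> the_cat) 18)"
  by (simp only: term_defs, code_simp)

lemma closed_goal:
  "concrete_cat 0 d = concrete_cat 0 0" "lift k (concrete_cat 0 0) = concrete_cat 0 0"
  "goal_fn d = goal_fn 0" "lift k (goal_fn 0) = goal_fn 0"
  by (simp_all add: term_defs)

lemma goal_level_0:
  "\<exists>t. has_type [] t ((\<^bold>\<Sigma>C:concrete_cat 0. path (cat_data 0) (underlying 0 C) (simplex_data 0)) 0)"
proof -
  have ctx: "ctx final_ctx" using conf_simplex by (rule ctx_telescope)
  note checked = check_def_sound[OF valid_sig_env well_typed_table2 ctx]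
  have cat: "has_type final_ctx (the_cat 18) (concrete_cat 0 0)"
    using checked[OF check_the_cat] by (simp add: closed_goal(1)[of 18])
  have path: "has_type final_ctx (the_path 18) (App (goal_fn 0) (the_cat 18))"
    using checked[OF check_the_path] by (simp add: app_def closed_goal(3)[of 18])
  have "well_typed (goal_fn 0) (goal_fn_type 0)"
    using well_typed_defs2 by (simp add: defs2_def)
  then have goal: "has_type final_ctx (goal_fn 0) (goal_fn_type 0)"
    using closed_weakening ctx unfolding well_typed_def by blast
  then have fn: "has_type final_ctx (goal_fn 0) (Pi (concrete_cat 0 0) (U 1))"
    by (simp add: goal_fn_type_def arrow_def pi_def univ_def)
  have "has_type [] (concrete_cat 0 0) (U 1)"
    using check_def_sound[OF valid_sig_env well_typed_table1 ctx_Nil check_concrete_cat] by blast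
  then have "has_type final_ctx (concrete_cat 0 0) (U 1)"
    using closed_weakening ctx type_U[OF ctx_Nil] unfolding is_type_def by blast
  from type_pair[OF this fn cat path]
  have pair: "has_type final_ctx (apps cPair [concrete_cat 0 0, goal_fn 0, the_cat 18, the_path 18])
     (apps cSigma [concrete_cat 0 0, goal_fn 0])" .
  have "lift 0 (apps cSigma [concrete_cat 0 0, goal_fn 0]) = apps cSigma [concrete_cat 0 0, goal_fn 0]"
    by (simp add: closed_goal(2,4))
  from provable_cut[OF conf_simplex pair this] show ?thesis
    by (simp add: sigma_def app_def cst_def goal_fn_def)
qed

theorem theorem2:
  fixes l :: nat
  shows "inhabited (\<^bold>\<Sigma>C:concrete_cat l. path (cat_data l) (underlying l C) (simplex_data l))"
proof -
  obtain t where
    "has_type [] t ((\<^bold>\<Sigma>C:concrete_cat 0. path (cat_data 0) (underlying 0 C) (simplex_data 0)) 0)"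
    using goal_level_0 by blast
  \<comment> \<open>Raising all levels by \<open>l\<close> turns the statement at level 0 into the
    one at level \<open>l\<close>.\<close>
  from typing_up(2)[OF this, of l] have
    "has_type [] (up l t) ((\<^bold>\<Sigma>C:concrete_cat l. path (cat_data l) (underlying l C) (simplex_data l)) 0)"
    by (simp add: term_defs)
  then show ?thesis unfolding inhabited_def ..
qed

end
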